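(* Let $X$ be a Banach function space over $\mathbb{R}^n$ such that $\frac{1}{1+|x|^n}\in X$. The following are equivalent: (i) $M$ is bounded on $MX$: there is $C>0$ such that for every $f\in MX$, $\|M(Mf)\|_X\le C\|Mf\|_X$. (ii) There exists $\lambda_0\in(0,1)$ such that for every $f\in X$, $\|Mf\|_X\le 2\|m_{\lambda_0}f\|_X$.
   Context: A Banach function space (BFS) $X$ over $\mathbb{R}^n$ with Lebesgue measure is a space of measurable functions with a norm $\|\cdot\|_X$ satisfying: - $\|f\|_X=0$ iff $f=0$ a.e.; - if $|g|\le|f|$ a.e. and $f\in X$, then $g\in X$ and $\|g\|_X\le\|f\|_X$; - the Fatou property: if $0\le f_j\uparrow f$ a.e., then $\|f_j\|_X\uparrow\|f\|_X$; - $\chi_E\in X$ for every set $E$ of finite measure; - for every $E$ of finite measure, $\int_E|f|\le C_E\|f\|_X$. $Mf(x)=\sup_{Q\ni x}\frac1{|Q|}\int_Q|f|$ is the Hardy–Littlewood maximal operator, with the supremum over cubes containing $x$. $MX$ is the space of measurable $f$ with $\|f\|_{MX}:=\|Mf\|_X<\infty$. For $\lambda\in(0,1)$, $$m_\lambda f(x)=\sup_{Q\ni x}(f\chi_Q)^*(\lambda|Q|),\qquad (f\chi_Q)^*(\lambda|Q|)=\inf\{\alpha>0:|\{y\in Q:|f(y)|>\alpha\}|\le\lambda|Q|\}.$$ *)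

theory Defs
  imports "HOL-Analysis.Analysis"
begin

text \<open>Banach function space over R^n (Lebesgue measure), given through its
function norm rho acting on nonnegative extended-valued functions
(Bennett--Sharpley style). The space is X = {f measurable. rho |f| < infinity}
and the X-norm of f is rho |f|.\<close>

definition banach_function_norm :: "((real^'n \<Rightarrow> ennreal) \<Rightarrow> ennreal) \<Rightarrow> bool" where
  "banach_function_norm N \<longleftrightarrow>
     (\<forall>f \<in> borel_measurable lebesgue. N f = 0 \<longleftrightarrow> (AE x in lebesgue. f x = 0)) \<and>
     (\<forall>f \<in> borel_measurable lebesgue. \<forall>g \<in> borel_measurable lebesgue.
         N (\<lambda>x. f x + g x) \<le> N f + N g) \<and>
     (\<forall>f \<in> borel_measurable lebesgue. \<forall>c::real. c \<ge> 0 \<longrightarrow>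
         N (\<lambda>x. ennreal c * f x) = ennreal c * N f) \<and>
     (\<forall>f \<in> borel_measurable lebesgue. \<forall>g \<in> borel_measurable lebesgue.
         (AE x in lebesgue. g x \<le> f x) \<longrightarrow> N g \<le> N f) \<and>
     (\<forall>F :: nat \<Rightarrow> real^'n \<Rightarrow> ennreal. \<forall>f \<in> borel_measurable lebesgue.
         (\<forall>j. F j \<in> borel_measurable lebesgue) \<longrightarrow>
         (AE x in lebesgue. incseq (\<lambda>j. F j x) \<and> (SUP j. F j x) = f x) \<longrightarrow>
         N f = (SUP j. N (F j))) \<and>
     (\<forall>E \<in> sets lebesgue. emeasure lebesgue E < \<infinity> \<longrightarrow> N (indicator E) < \<infinity>) \<and>
     (\<forall>E \<in> sets lebesgue. emeasure lebesgue E < \<infinity> \<longrightarrow>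
         (\<exists>C::real. \<forall>f \<in> borel_measurable lebesgue.
             set_nn_integral lebesgue E f \<le> ennreal C * N f))"

definition in_bfs :: "((real^'n \<Rightarrow> ennreal) \<Rightarrow> ennreal) \<Rightarrow> (real^'n \<Rightarrow> real) \<Rightarrow> bool" where
  "in_bfs N f \<longleftrightarrow> f \<in> borel_measurable lebesgue \<and> N (\<lambda>x. ennreal \<bar>f x\<bar>) < \<infinity>"

definition cube :: "real^'n \<Rightarrow> real \<Rightarrow> (real^'n) set" where
  "cube a h = cbox a (a + h *\<^sub>R One)"

definition maxop :: "(real^'n \<Rightarrow> ennreal) \<Rightarrow> real^'n \<Rightarrow> ennreal" where
  "maxop g x = (SUP Q \<in> {cube a h | a h. h > 0 \<and> x \<in> cube a h}.
       (\<integral>\<^sup>+ y \<in> Q. g y \<partial>lebesgue) / emeasure lebesgue Q)"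

abbreviation M :: "(real^'n \<Rightarrow> real) \<Rightarrow> real^'n \<Rightarrow> ennreal" where
  "M f \<equiv> maxop (\<lambda>y. ennreal \<bar>f y\<bar>)"

definition local_rearr :: "real \<Rightarrow> (real^'n \<Rightarrow> real) \<Rightarrow> (real^'n) set \<Rightarrow> ennreal" where
  "local_rearr lam f Q = Inf {ennreal \<alpha> | \<alpha>. \<alpha> > 0 \<and>
      emeasure lebesgue {y \<in> Q. \<bar>f y\<bar> > \<alpha>} \<le> ennreal lam * emeasure lebesgue Q}"

definition local_maxop :: "real \<Rightarrow> (real^'n \<Rightarrow> real) \<Rightarrow> real^'n \<Rightarrow> ennreal" where
  "local_maxop lam f x = (SUP Q \<in> {cube a h | a h. h > 0 \<and> x \<in> cube a h}. local_rearr lam f Q)"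

end

(*
Write n for the dimension and D for a constant depending only on n.

For a set E of measure at most 2^(-K-1) |Q| inside a cube Q, the L log L estimate gives
K * (integral of |f| over E) <= D |Q| MMf(x) for x in Q: on each of the K levels a = 2^k A, where A is
the average of |f| chi_E over Q, half of the integral of |f| chi_E lives on {|f| chi_E > a}, so a reverse
weak type inequality bounds it by a multiple of a * |{M(|f| chi_E) > a}|, and the sum of those
a that are smaller than M(|f| chi_E) is at most 2 M(|f| chi_E). Splitting the average of |f| over Q
at the height of the rearrangement then yields Mf <= m_lam f + (D/K) MMf pointwise, lam = 2^(-K-1). If M is
bounded on MX and K is large, the last term is absorbed for f with Mf in X; bounded f with bounded
support have this property because Mf is dominated by a multiple of 1/(1+|x|^n), and a general f
follows by the Fatou property.

Conversely the weak type (1,1) inequality, localised to the triple of a cube, gives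
m_lam(Mf) <= C Mf pointwise, so (ii) applied to Mf is the boundedness of M on MX.
*)

theory Submission
  imports Defs
begin

section \<open>Cubes, averages and measurability\<close>

text \<open>Keeps measures in the form \<open>emeasure lebesgue\<close> instead of the
  \<open>lborel\<close> measure of a main part.\<close>

declare emeasure_completion [simp del]

text \<open>\<open>One\<close> is the sum of \<open>Basis\<close>, so this computes its coordinates
  and reduces inclusions between cubes to inequalities between reals.\<close>

lemma sum_Basis_nth [simp]: "(\<Sum>b\<in>Basis. (b :: real^'n) $ i) = 1"
proof -
  have "(\<Sum>b\<in>Basis. 1 *\<^sub>R b) \<bullet> axis i (1::real) = 1"
    by (rule inner_sum_left_Basis) simp
  then show ?thesis by (simp add: cart_eq_inner_axis inner_sum_left)
qed

lemma mem_cube: "(x :: real^'n) \<in> cube a h \<longleftrightarrow> (\<forall>i. a $ i \<le> x $ i \<and> x $ i \<le> a $ i + h)"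
  by (simp add: cube_def mem_box_cart)

lemma cube_subsetI:
  fixes a b :: "real^'n"
  assumes "\<And>i. b $ i \<le> a $ i" "\<And>i. a $ i + h \<le> b $ i + k"
  shows "cube a h \<subseteq> cube b k"
proof (rule subsetI, unfold mem_cube, rule allI)
  fix x i assume "\<forall>i. a $ i \<le> x $ i \<and> x $ i \<le> a $ i + h"
  from spec[OF this, of i] show "b $ i \<le> x $ i \<and> x $ i \<le> b $ i + k"
    using assms[of i] by auto
qed

lemma sets_cube [measurable]: "cube a h \<in> sets lebesgue"
  by (simp add: cube_def)

lemma emeasure_cube: "0 \<le> h \<Longrightarrow> emeasure lebesgue (cube (a :: real^'n) h) = ennreal (h ^ CARD('n))"
  by (simp add: cube_def emeasure_completion emeasure_lborel_cbox_eq inner_add_left)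

text \<open>The integral is not divided by the volume, so that statements about averages become
  products in \<open>ennreal\<close>, free of division.\<close>

definition cube_int :: "(real^'n \<Rightarrow> ennreal) \<Rightarrow> real^'n \<Rightarrow> real \<Rightarrow> ennreal" where
  "cube_int g a h = (\<integral>\<^sup>+ y \<in> cube a h. g y \<partial>lebesgue)"

lemma ennreal_le_divide_pos:
  fixes c b :: ennreal assumes "0 < r"
  shows "b / ennreal r \<le> c \<longleftrightarrow> b \<le> c * ennreal r"
    and "c < b / ennreal r \<longleftrightarrow> c * ennreal r < b"
proof -
  have *: "b / ennreal r \<le> c \<longleftrightarrow> b \<le> c * ennreal r" for b c
  proof
    assume "b / ennreal r \<le> c"
    then have "b / ennreal r * ennreal r \<le> c * ennreal r" by (rule mult_right_mono) simp
    then show "b \<le> c * ennreal r" using assms by (simp add: ennreal_divide_times)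
  qed (use assms in \<open>simp add: divide_le_posI_ennreal mult.commute\<close>)
  show "b / ennreal r \<le> c \<longleftrightarrow> b \<le> c * ennreal r" by (rule *)
  show "c < b / ennreal r \<longleftrightarrow> c * ennreal r < b"
    using * by (metis not_le)
qed

lemma maxop_le_iff:
  fixes g :: "real^'n \<Rightarrow> ennreal"
  shows "maxop g x \<le> c \<longleftrightarrow>
    (\<forall>a h. 0 < h \<longrightarrow> x \<in> cube a h \<longrightarrow> cube_int g a h \<le> c * ennreal (h ^ CARD('n)))"
proof -
  have "maxop g x \<le> c \<longleftrightarrow> (\<forall>a h. 0 < h \<longrightarrow> x \<in> cube a h \<longrightarrow>
      (\<integral>\<^sup>+ y \<in> cube a h. g y \<partial>lebesgue) / emeasure lebesgue (cube a h) \<le> c)"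
    unfolding maxop_def SUP_le_iff by auto
  then show ?thesis by (simp add: cube_int_def emeasure_cube ennreal_le_divide_pos)
qed

lemma cube_int_le:
  fixes g :: "real^'n \<Rightarrow> ennreal"
  assumes "0 < h" "x \<in> cube a h"
  shows "cube_int g a h \<le> maxop g x * ennreal (h ^ CARD('n))"
  using maxop_le_iff[of g x "maxop g x"] assms by auto

lemma less_maxop_iff:
  fixes g :: "real^'n \<Rightarrow> ennreal"
  shows "c < maxop g x \<longleftrightarrow>
    (\<exists>a h. 0 < h \<and> x \<in> cube a h \<and> c * ennreal (h ^ CARD('n)) < cube_int g a h)"
  using maxop_le_iff[of g x c] by (auto simp: not_le[symmetric])

lemma cube_int_mono: "cube a h \<subseteq> cube b k \<Longrightarrow> cube_int g a h \<le> cube_int g b k"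
  unfolding cube_int_def by (intro nn_integral_mono) (auto split: split_indicator)

lemma maxop_mono: "(\<And>y. f y \<le> g y) \<Longrightarrow> maxop f x \<le> maxop g x"
  unfolding maxop_def by (intro SUP_mono' divide_right_mono_ennreal nn_integral_mono mult_right_mono) auto

lemma maxop_cong_AE:
  assumes "AE y in lebesgue. f y = g y"
  shows "maxop f x = maxop g x"
proof -
  have "(\<integral>\<^sup>+ y \<in> Q. f y \<partial>lebesgue) = (\<integral>\<^sup>+ y \<in> Q. g y \<partial>lebesgue)" for Q
    using assms by (intro nn_integral_cong_AE) auto
  then show ?thesis by (simp add: maxop_def)
qed

text \<open>A point may lie on the boundary of its closed cube. After a small enlargement that
  preserves \<open>\<Phi>\<close> it is an interior point, and the enlarged cube then serves all
  nearby points.\<close>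

lemma open_cube_SUP:
  fixes \<Phi> :: "(real^'n) \<Rightarrow> real \<Rightarrow> bool"
  assumes enlarge: "\<And>a h. 0 < h \<Longrightarrow> \<Phi> a h \<Longrightarrow> \<exists>e>0. \<Phi> (a - e *\<^sub>R One) (h + 2 * e)"
  shows "open {x. \<exists>a h. 0 < h \<and> x \<in> cube a h \<and> \<Phi> a h}"
proof (subst open_subopen, intro ballI)
  fix x assume "x \<in> {x. \<exists>a h. 0 < h \<and> x \<in> cube a h \<and> \<Phi> a h}"
  then obtain a h where h: "0 < h" "x \<in> cube a h" "\<Phi> a h" by auto
  from enlarge[OF h(1,3)] obtain e where e: "0 < e" "\<Phi> (a - e *\<^sub>R One) (h + 2 * e)" by auto
  let ?a = "a - e *\<^sub>R One" and ?b = "a + (h + e) *\<^sub>R One"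
  have "x \<in> box ?a ?b"
    unfolding mem_box_cart
  proof
    fix i show "?a $ i < x $ i \<and> x $ i < ?b $ i"
      using h(2) e(1) by (auto simp: mem_cube algebra_simps dest: spec[of _ i])
  qed
  moreover have "box ?a ?b \<subseteq> cube ?a (h + 2 * e)"
  proof -
    have "?a + (h + 2 * e) *\<^sub>R One = ?b" by (simp add: vec_eq_iff)
    then show ?thesis unfolding cube_def using box_subset_cbox by metis
  qed
  ultimately show "\<exists>T. open T \<and> x \<in> T \<and> T \<subseteq> {x. \<exists>a h. 0 < h \<and> x \<in> cube a h \<and> \<Phi> a h}"
    using h e by (intro exI[of _ "box ?a ?b"]) (auto intro!: exI[of _ ?a] exI[of _ "h + 2 * e"])
qed

lemma cube_subset_enlarge: "0 \<le> e \<Longrightarrow> cube a h \<subseteq> cube (a - e *\<^sub>R One) (h + 2 * e)"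
  by (intro cube_subsetI) auto

text \<open>By continuity of the volume in the side length; \<open>c\<close> is finite, since
  otherwise the left side of the strict inequality would be infinite.\<close>

lemma less_enlarge:
  fixes c v :: ennreal
  assumes "c * ennreal (h ^ n) < v" "0 < h"
  obtains e where "0 < e" "c * ennreal ((h + 2 * e) ^ n) < v"
proof -
  have "c * ennreal (h ^ n) < top" using assms(1) by (rule order.strict_trans2) simp
  then have "c \<noteq> top" using assms(2) by (auto simp: ennreal_top_mult split: if_splits)
  have "((\<lambda>e. c * ennreal ((h + 2 * e) ^ n)) \<longlongrightarrow> c * ennreal ((h + 2 * 0) ^ n)) (at_right 0)"
    using \<open>c \<noteq> top\<close> by (intro ennreal_tendsto_cmult tendsto_ennrealI tendsto_intros) (auto simp: less_top)
  then have "\<forall>\<^sub>F e in at_right 0. c * ennreal ((h + 2 * e) ^ n) < v"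
    by (rule order_tendstoD) (use assms in simp)
  moreover have "\<forall>\<^sub>F e::real in at_right 0. 0 < e"
    by (simp add: eventually_at_right_less)
  ultimately have "\<forall>\<^sub>F e in at_right 0. 0 < e \<and> c * ennreal ((h + 2 * e) ^ n) < v"
    by eventually_elim auto
  then have "\<exists>e. 0 < e \<and> c * ennreal ((h + 2 * e) ^ n) < v"
    by (rule eventually_happens'[rotated]) simp
  then show ?thesis using that by blast
qed

text \<open>Lower semicontinuity: enlarging a cube can only increase the integral, while the volume
  changes continuously.\<close>

lemma open_less_maxop: "open {x :: real^'n. c < maxop g x}"
  unfolding less_maxop_iff
proof (rule open_cube_SUP)
  fix a :: "real^'n" and h :: real
  assume h: "0 < h" "c * ennreal (h ^ CARD('n)) < cube_int g a h"
  from less_enlarge[OF h(2,1)] obtain e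
    where e: "0 < e" "c * ennreal ((h + 2 * e) ^ CARD('n)) < cube_int g a h" .
  show "\<exists>e>0. c * ennreal ((h + 2 * e) ^ CARD('n)) < cube_int g (a - e *\<^sub>R One) (h + 2 * e)"
    using e cube_int_mono[OF cube_subset_enlarge[of e a h], of g] by (intro exI[of _ e]) auto
qed

lemma borel_measurable_lebesgueI_open:
  fixes f :: "real^'n \<Rightarrow> ennreal"
  assumes "\<And>c. open {x. c < f x}"
  shows "f \<in> borel_measurable lebesgue"
  using assms by (intro borel_measurableI_greater) (simp add: borel_open)

lemma measurable_maxop [measurable]: "maxop g \<in> borel_measurable lebesgue"
  by (intro borel_measurable_lebesgueI_open open_less_maxop)

lemma less_local_maxop_iff:
  fixes f :: "real^'n \<Rightarrow> real"
  shows "c < local_maxop lam f x \<longleftrightarrow> (\<exists>a h. 0 < h \<and> x \<in> cube a h \<and> c < local_rearr lam f (cube a h))"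
  by (auto simp: local_maxop_def less_SUP_iff)

lemma measurable_local_maxop [measurable]:
  fixes f :: "real^'n \<Rightarrow> real"
  assumes [measurable]: "f \<in> borel_measurable lebesgue"
  shows "local_maxop lam f \<in> borel_measurable lebesgue"
proof (rule borel_measurable_lebesgueI_open, unfold less_local_maxop_iff, rule open_cube_SUP)
  fix c :: ennreal and a :: "real^'n" and h :: real
  assume h: "0 < h" "c < local_rearr lam f (cube a h)"
  \<comment> \<open>A finite level strictly in between leaves room: the set where
    \<open>\<bar>f y\<bar> > r\<close> is too large in the cube and stays too large in a slightly
    bigger one, whose rearrangement is therefore at least \<open>d\<close>.\<close>
  obtain d where d: "c < d" "d < local_rearr lam f (cube a h)" using dense h by blast
  obtain r where r: "d = ennreal r" "0 \<le> r" using d by (cases d) auto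
  \<comment> \<open>The infimum in \<open>local_rearr\<close> runs over positive levels
    only.\<close>
  then have r0: "0 < r" using d by (cases "r = 0") auto
  let ?E = "\<lambda>a h. {y \<in> cube a h. \<bar>f y\<bar> > r}"
  have "\<not> emeasure lebesgue (?E a h) \<le> ennreal lam * emeasure lebesgue (cube a h)"
  proof
    assume "emeasure lebesgue (?E a h) \<le> ennreal lam * emeasure lebesgue (cube a h)"
    then have "local_rearr lam f (cube a h) \<le> d"
      unfolding local_rearr_def r using r0 by (intro Inf_lower) auto
    with d show False by simp
  qed
  then have "ennreal lam * ennreal (h ^ CARD('n)) < emeasure lebesgue (?E a h)"
    using h by (simp add: emeasure_cube not_le)
  from less_enlarge[OF this h(1)] obtain e
    where e: "0 < e" "ennreal lam * ennreal ((h + 2 * e) ^ CARD('n)) < emeasure lebesgue (?E a h)" .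
  let ?a = "a - e *\<^sub>R One" and ?h = "h + 2 * e"
  have "emeasure lebesgue (?E a h) \<le> emeasure lebesgue (?E ?a ?h)"
    using cube_subset_enlarge[of e a h] e by (intro emeasure_mono) auto
  then have big: "ennreal lam * emeasure lebesgue (cube ?a ?h) < emeasure lebesgue (?E ?a ?h)"
    using e h by (simp add: emeasure_cube)
  have "d \<le> local_rearr lam f (cube ?a ?h)"
    unfolding local_rearr_def
  proof (rule Inf_greatest, clarify)
    fix s :: real
    assume s: "0 < s" "emeasure lebesgue {y \<in> cube ?a ?h. s < \<bar>f y\<bar>} \<le> ennreal lam * emeasure lebesgue (cube ?a ?h)"
    have "r \<le> s"
    proof (rule ccontr)
      assume "\<not> r \<le> s"
      then have "emeasure lebesgue (?E ?a ?h) \<le> emeasure lebesgue {y \<in> cube ?a ?h. s < \<bar>f y\<bar>}"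
        by (intro emeasure_mono) auto
      with s big show False by simp
    qed
    then show "d \<le> ennreal s" by (simp add: r ennreal_leI)
  qed
  then show "\<exists>e>0. c < local_rearr lam f (cube (a - e *\<^sub>R One) (h + 2 * e))"
    using d e by (intro exI[of _ e]) auto
qed

section \<open>The Vitali covering lemma for cubes and weak type inequalities\<close>

text \<open>Countable subadditivity for \<open>A\<close> and countable additivity for
  \<open>B\<close>. In the applications one of the two measures has density \<open>g\<close>, and
  the \<open>B i\<close> are selected cubes or the interiors of a cover.\<close>

lemma emeasure_UN_le_disjoint:
  assumes C: "countable C"
    and sets: "\<And>i. i \<in> C \<Longrightarrow> A i \<in> sets \<mu>" "\<And>i. i \<in> C \<Longrightarrow> B i \<in> sets \<nu>"
    and disj: "disjoint_family_on B C"
    and le: "\<And>i. i \<in> C \<Longrightarrow> emeasure \<mu> (A i) \<le> c * emeasure \<nu> (B i)"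
  shows "emeasure \<mu> (\<Union>i\<in>C. A i) \<le> c * emeasure \<nu> (\<Union>i\<in>C. B i)"
proof -
  \<comment> \<open>The countable set \<open>C\<close> may be finite; the fibres of its numbering,
    each empty or a singleton, allow indexing by the natural numbers.\<close>
  define S where "S k = {i \<in> C. to_nat_on C i = k}" for k
  have inj: "i = j" if "i \<in> S k" "j \<in> S k" for i j k
    using that inj_on_to_nat_on[OF C] by (auto simp: S_def inj_on_def)
  have S: "S k = {} \<or> (\<exists>i\<in>C. S k = {i})" for k
  proof (cases "S k = {}")
    case False
    then obtain i where "i \<in> S k" by auto
    moreover from this have "S k = {i}" using inj by blast
    ultimately show ?thesis by (auto simp: S_def)
  qed simp
  have UN: "(\<Union>i\<in>C. X i) = (\<Union>k. \<Union>i\<in>S k. X i)" for X :: "'a \<Rightarrow> 'c set"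
    by (auto simp: S_def)
  have UN': "(\<Union>i\<in>C. X i) = (\<Union>k. \<Union>i\<in>S k. X i)" for X :: "'a \<Rightarrow> 'b set"
    by (auto simp: S_def)
  have mA: "(\<Union>i\<in>S k. A i) \<in> sets \<mu>" and mB: "(\<Union>i\<in>S k. B i) \<in> sets \<nu>"
    and leS: "emeasure \<mu> (\<Union>i\<in>S k. A i) \<le> c * emeasure \<nu> (\<Union>i\<in>S k. B i)" for k
    using S[of k] sets le by auto
  have dB: "disjoint_family (\<lambda>k. \<Union>i\<in>S k. B i)"
    using disj unfolding disjoint_family_on_def S_def by fastforce
  have "emeasure \<mu> (\<Union>i\<in>C. A i) \<le> (\<Sum>k. emeasure \<mu> (\<Union>i\<in>S k. A i))"
    unfolding UN UN' using mA by (intro emeasure_subadditive_countably) auto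
  also have "\<dots> \<le> (\<Sum>k. c * emeasure \<nu> (\<Union>i\<in>S k. B i))"
    by (intro suminf_le leS) auto
  also have "\<dots> = c * (\<Sum>k. emeasure \<nu> (\<Union>i\<in>S k. B i))" by simp
  also have "(\<Sum>k. emeasure \<nu> (\<Union>i\<in>S k. B i)) = emeasure \<nu> (\<Union>i\<in>C. B i)"
    unfolding UN UN' using mB dB by (intro suminf_emeasure) auto
  finally show ?thesis .
qed

text \<open>The concentric cube of side 10 n h. The original cube lies in the ball of radius n h
  about the common centre, and the big cube contains the fivefold ball, as the Vitali lemma
  requires.\<close>

definition big_cube :: "real^'n \<Rightarrow> real \<Rightarrow> (real^'n) set" where
  "big_cube a h = cube (a + (h / 2 - 5 * real CARD('n) * h) *\<^sub>R One) (10 * real CARD('n) * h)"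

lemma sets_big_cube [measurable]: "big_cube a h \<in> sets lebesgue"
  by (simp add: big_cube_def)

lemma CARD_ge_1: "1 \<le> real CARD('n::finite)"
  using one_le_card_finite[where 'a = 'n] by simp

lemma cube_subset_cball:
  fixes a :: "real^'n"
  assumes "0 < h"
  shows "cube a h \<subseteq> cball (a + (h / 2) *\<^sub>R One) (real CARD('n) * h)"
proof
  fix x assume x: "x \<in> cube a h"
  let ?c = "a + (h / 2) *\<^sub>R One"
  have "\<bar>(x - ?c) $ i\<bar> \<le> h" for i
    using x assms by (auto simp: mem_cube abs_le_iff dest!: spec[of _ i])
  then have "norm (x - ?c) \<le> (\<Sum>i\<in>(UNIV::'n set). h)"
    by (intro order_trans[OF norm_le_l1_cart] sum_mono) simp
  then show "x \<in> cball ?c (real CARD('n) * h)"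
    by (simp add: dist_norm norm_minus_commute)
qed

lemma cball_subset_big_cube:
  fixes a :: "real^'n"
  shows "cball (a + (h / 2) *\<^sub>R One) (5 * (real CARD('n) * h)) \<subseteq> big_cube a h"
proof
  fix x assume x: "x \<in> cball (a + (h / 2) *\<^sub>R One) (5 * (real CARD('n) * h))"
  show "x \<in> big_cube a h" unfolding big_cube_def mem_cube
  proof
    fix i
    let ?c = "a + (h / 2) *\<^sub>R (One :: real^'n)"
    have "\<bar>(x - ?c) $ i\<bar> \<le> 5 * (real CARD('n) * h)"
      using component_le_norm_cart[of "x - ?c" i] x by (simp add: dist_norm norm_minus_commute)
    then show "(a + (h / 2 - 5 * real CARD('n) * h) *\<^sub>R One) $ i \<le> x $ i \<and>
        x $ i \<le> (a + (h / 2 - 5 * real CARD('n) * h) *\<^sub>R One) $ i + 10 * real CARD('n) * h"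
      by (simp add: abs_le_iff algebra_simps)
  qed
qed

lemma cube_subset_big_cube: "0 < h \<Longrightarrow> cube a h \<subseteq> big_cube a h"
  for a :: "real^'n"
proof -
  assume "0 < h"
  then have "cball (a + (h / 2) *\<^sub>R One) (real CARD('n) * h)
      \<subseteq> cball (a + (h / 2) *\<^sub>R One) (5 * (real CARD('n) * h))"
    by (intro subset_cball) simp
  then show ?thesis
    using cube_subset_cball[OF \<open>0 < h\<close>, of a] cball_subset_big_cube[of a h] by blast
qed

lemma emeasure_big_cube:
  "0 < h \<Longrightarrow> emeasure lebesgue (big_cube (a :: real^'n) h)
     = ennreal ((10 * real CARD('n)) ^ CARD('n)) * emeasure lebesgue (cube a h)"
  by (simp add: big_cube_def emeasure_cube power_mult_distrib flip: ennreal_mult)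

text \<open>The Vitali lemma for balls is applied to the balls of radius n h around the cubes:
  disjoint balls give disjoint cubes, and the fivefold balls fit into the big cubes.\<close>

lemma cube_Vitali:
  fixes a :: "'i \<Rightarrow> real^'n"
  assumes h: "\<And>i. i \<in> I \<Longrightarrow> 0 < h i \<and> h i \<le> B"
  obtains C where "countable C" "C \<subseteq> I" "disjoint_family_on (\<lambda>i. cube (a i) (h i)) C"
    "(\<Union>i\<in>I. cube (a i) (h i)) \<subseteq> (\<Union>i\<in>C. big_cube (a i) (h i))"
proof -
  let ?c = "\<lambda>i. a i + (h i / 2) *\<^sub>R One" and ?r = "\<lambda>i. real CARD('n) * h i"
  have r: "0 < ?r i \<and> ?r i \<le> real CARD('n) * B" if "i \<in> I" for i
    using h[OF that] by (auto intro!: mult_left_mono)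
  obtain C where C: "countable C" "C \<subseteq> I"
    and d: "pairwise (\<lambda>i j. disjnt (cball (?c i) (?r i)) (cball (?c j) (?r j))) C"
    and cov: "(\<Union>i\<in>I. cball (?c i) (?r i)) \<subseteq> (\<Union>i\<in>C. cball (?c i) (5 * ?r i))"
    by (rule Vitali_covering_lemma_cballs[OF order_refl r])
  have sub: "cube (a i) (h i) \<subseteq> cball (?c i) (?r i)" if "i \<in> I" for i
    using h that by (intro cube_subset_cball) auto
  show thesis
  proof (rule that[OF C])
    show "disjoint_family_on (\<lambda>i. cube (a i) (h i)) C"
      unfolding disjoint_family_on_def
    proof (intro ballI impI)
      fix i j assume "i \<in> C" "j \<in> C" "i \<noteq> j"
      then have "cball (?c i) (?r i) \<inter> cball (?c j) (?r j) = {}"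
        using d by (auto simp: pairwise_def disjnt_def)
      then show "cube (a i) (h i) \<inter> cube (a j) (h j) = {}"
        using sub[of i] sub[of j] C \<open>i \<in> C\<close> \<open>j \<in> C\<close> by blast
    qed
    have "(\<Union>i\<in>I. cube (a i) (h i)) \<subseteq> (\<Union>i\<in>I. cball (?c i) (?r i))"
      using sub by blast
    also note cov
    also have "(\<Union>i\<in>C. cball (?c i) (5 * ?r i)) \<subseteq> (\<Union>i\<in>C. big_cube (a i) (h i))"
      using cball_subset_big_cube by blast
    finally show "(\<Union>i\<in>I. cube (a i) (h i)) \<subseteq> (\<Union>i\<in>C. big_cube (a i) (h i))" .
  qed
qed

section \<open>Weak type (1,1) inequality and its reverse\<close>

lemma cube_int_eq_emeasure:
  "g \<in> borel_measurable lebesgue \<Longrightarrow> cube_int g a h = emeasure (density lebesgue g) (cube a h)"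
  by (simp add: cube_int_def emeasure_density)

lemma cube_int_le_nn_integral: "cube_int g a h \<le> (\<integral>\<^sup>+ y. g y \<partial>lebesgue)"
  unfolding cube_int_def by (intro nn_integral_mono) (auto split: split_indicator)

text \<open>Every point of the level set lies in a cube with average above \<alpha>. The big cubes
  of a disjoint subfamily cover the level set, and the integrals over the disjoint cubes add up to
  at most the integral of \<open>g\<close>.\<close>

lemma maxop_weak_type:
  fixes g :: "real^'n \<Rightarrow> ennreal"
  assumes g [measurable]: "g \<in> borel_measurable lebesgue" and \<alpha>: "0 < \<alpha>"
  shows "ennreal \<alpha> * emeasure lebesgue {x. ennreal \<alpha> < maxop g x}
    \<le> ennreal ((10 * real CARD('n)) ^ CARD('n)) * (\<integral>\<^sup>+ y. g y \<partial>lebesgue)"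
proof (cases "(\<integral>\<^sup>+ y. g y \<partial>lebesgue) = top")
  case True
  then show ?thesis by (simp add: ennreal_mult_top)
next
  case False
  then obtain I where I: "(\<integral>\<^sup>+ y. g y \<partial>lebesgue) = ennreal I" "0 \<le> I"
    by (cases "(\<integral>\<^sup>+ y. g y \<partial>lebesgue)") auto
  let ?G = "{x. ennreal \<alpha> < maxop g x}" and ?\<kappa> = "(10 * real CARD('n)) ^ CARD('n)"
  have "\<forall>x\<in>?G. \<exists>a h. 0 < h \<and> x \<in> cube a h \<and> ennreal \<alpha> * ennreal (h ^ CARD('n)) < cube_int g a h"
    by (auto simp: less_maxop_iff)
  then obtain a h where P: "\<And>x. x \<in> ?G \<Longrightarrow> 0 < h x" "\<And>x. x \<in> ?G \<Longrightarrow> x \<in> cube (a x) (h x)"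
    "\<And>x. x \<in> ?G \<Longrightarrow> ennreal \<alpha> * ennreal (h x ^ CARD('n)) < cube_int g (a x) (h x)"
    by metis
  \<comment> \<open>The Vitali selection needs bounded sides: \<alpha> h^n is below the total
    integral, and h is at most h^n as soon as h > 1.\<close>
  have "h x \<le> max 1 (I / \<alpha>)" if "x \<in> ?G" for x
  proof (cases "h x \<le> 1")
    case False
    have "ennreal (\<alpha> * h x ^ CARD('n)) < ennreal I"
      using P[OF that] cube_int_le_nn_integral[of g "a x" "h x"] \<alpha> I
      by (auto simp: ennreal_mult)
    then have "h x ^ CARD('n) < I / \<alpha>"
      using \<alpha> P(1)[OF that] by (subst (asm) ennreal_less_iff) (auto simp: field_simps)
    moreover have "h x \<le> h x ^ CARD('n)" using False by (intro self_le_power) auto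
    ultimately show ?thesis by simp
  qed simp
  then have "0 < h x \<and> h x \<le> max 1 (I / \<alpha>)" if "x \<in> ?G" for x using P(1) that by blast
  then obtain C where C: "countable C" "C \<subseteq> ?G" "disjoint_family_on (\<lambda>x. cube (a x) (h x)) C"
    "(\<Union>x\<in>?G. cube (a x) (h x)) \<subseteq> (\<Union>x\<in>C. big_cube (a x) (h x))"
    by (rule cube_Vitali)
  have "emeasure lebesgue ?G \<le> emeasure lebesgue (\<Union>x\<in>C. big_cube (a x) (h x))"
    using C P(2) by (intro emeasure_mono sets.countable_UN') (auto, blast)
  also have "\<dots> \<le> ennreal (?\<kappa> / \<alpha>) * emeasure (density lebesgue g) (\<Union>x\<in>C. cube (a x) (h x))"
  proof (rule emeasure_UN_le_disjoint[OF C(1) _ _ C(3)])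
    fix x assume "x \<in> C"
    with C(2) have x: "x \<in> ?G" by blast
    have "emeasure lebesgue (big_cube (a x) (h x))
        = ennreal (?\<kappa> / \<alpha>) * (ennreal \<alpha> * ennreal (h x ^ CARD('n)))"
      using P(1)[OF x] \<alpha> by (simp add: emeasure_big_cube emeasure_cube flip: ennreal_mult)
    also have "\<dots> \<le> ennreal (?\<kappa> / \<alpha>) * emeasure (density lebesgue g) (cube (a x) (h x))"
      using P(3)[OF x] by (intro mult_left_mono) (auto simp: cube_int_eq_emeasure)
    finally show "emeasure lebesgue (big_cube (a x) (h x))
        \<le> ennreal (?\<kappa> / \<alpha>) * emeasure (density lebesgue g) (cube (a x) (h x))" .
  qed auto
  also have "emeasure (density lebesgue g) (\<Union>x\<in>C. cube (a x) (h x)) \<le> emeasure (density lebesgue g) UNIV"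
    by (intro emeasure_mono) auto
  also have "\<dots> = ennreal I" by (simp add: emeasure_density I)
  finally have "ennreal \<alpha> * emeasure lebesgue ?G \<le> ennreal \<alpha> * (ennreal (?\<kappa> / \<alpha>) * ennreal I)"
    by (simp add: mult_left_mono)
  also have "\<dots> = ennreal ?\<kappa> * ennreal I"
    using \<alpha> I by (simp flip: ennreal_mult)
  finally show ?thesis by (simp add: I)
qed

text \<open>Takes the place of the Lebesgue differentiation theorem: F is covered by nonoverlapping
  cubes inside an open set of almost the same measure. Each cube contains a point of F, so the
  average of \<open>g\<close> over it is at most \<alpha>.\<close>

lemma set_nn_integral_le_of_maxop_le:
  fixes g :: "real^'n \<Rightarrow> ennreal"
  assumes g [measurable]: "g \<in> borel_measurable lebesgue" and F [measurable]: "F \<in> sets lebesgue"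
    and sub: "F \<subseteq> cube a h" "0 < h" and \<alpha>: "0 \<le> \<alpha>"
    and le: "\<And>x. x \<in> F \<Longrightarrow> maxop g x \<le> ennreal \<alpha>"
  shows "(\<integral>\<^sup>+ x \<in> F. g x \<partial>lebesgue) \<le> ennreal \<alpha> * emeasure lebesgue F"
proof (rule ennreal_le_epsilon)
  fix e :: real assume "0 < e"
  \<comment> \<open>The denominator \<alpha> + 1 also handles \<alpha> = 0.\<close>
  define d where "d = e / (\<alpha> + 1)"
  have d: "0 < d" "\<alpha> * d \<le> e" using \<open>0 < e\<close> \<alpha> by (auto simp: d_def field_simps)
  obtain T where T: "open T" "F \<subseteq> T" "T - F \<in> lmeasurable" "emeasure lebesgue (T - F) < ennreal d"
    using sets_lebesgue_outer_open[OF F d(1)] .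
  \<comment> \<open>Each covering cube lies in the gauge set of one of its points in F, hence in T;
    the value off T only serves to make this a gauge.\<close>
  define \<gamma> where "\<gamma> x = (if x \<in> T then T else UNIV)" for x
  have "gauge \<gamma>" using T(1) by (auto simp: gauge_def \<gamma>_def)
  let ?b = "a + h *\<^sub>R One"
  have ne: "box a ?b \<noteq> {}" using sub(2) by (auto simp: box_ne_empty inner_add_left)
  obtain D where D: "countable D"
    "\<And>K. K \<in> D \<Longrightarrow> interior K \<noteq> {} \<and> (\<exists>c d. K = cbox c d)"
    "pairwise (\<lambda>A B. interior A \<inter> interior B = {}) D"
    "\<And>K. K \<in> D \<Longrightarrow> \<exists>x \<in> F \<inter> K. K \<subseteq> \<gamma> x"
    "\<And>u v. cbox u v \<in> D \<Longrightarrow> \<exists>n. \<forall>i \<in> Basis. v \<bullet> i - u \<bullet> i = (?b \<bullet> i - a \<bullet> i) / 2^n"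
    "F \<subseteq> \<Union>D"
    by (rule covering_lemma[OF sub(1)[unfolded cube_def] ne \<open>gauge \<gamma>\<close>]) blast
  \<comment> \<open>The covering boxes are dyadic pieces of a cube, so all sides of one box have the
    same length.\<close>
  have cubes: "\<exists>c k. 0 < k \<and> K = cube c k" if K: "K \<in> D" for K
  proof -
    obtain u v where uv: "K = cbox u v" using D(2)[OF K] by auto
    obtain n where n: "\<And>i. i \<in> Basis \<Longrightarrow> v \<bullet> i - u \<bullet> i = (?b \<bullet> i - a \<bullet> i) / 2^n"
      using D(5) K uv by blast
    have "v = u + (h / 2 ^ n) *\<^sub>R One"
      by (rule euclidean_eqI) (use n in \<open>simp add: inner_add_left algebra_simps\<close>)
    then show ?thesis using sub(2) uv by (intro exI[of _ u] exI[of _ "h / 2 ^ n"]) (auto simp: cube_def)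
  qed
  have D_sets: "K \<in> sets lebesgue" if "K \<in> D" for K
    using cubes[OF that] by (metis sets_cube)
  have sT: "K \<subseteq> T" if "K \<in> D" for K
    using D(4)[OF that] T(2) by (auto simp: \<gamma>_def subset_iff)
  have "(\<integral>\<^sup>+ x \<in> F. g x \<partial>lebesgue) = emeasure (density lebesgue g) F"
    by (simp add: emeasure_density)
  also have "\<dots> \<le> emeasure (density lebesgue g) (\<Union>K\<in>D. K)"
    using D(1,6) D_sets by (intro emeasure_mono sets.countable_UN') auto
  \<comment> \<open>Subadditivity is applied to the closed cubes, additivity to their disjoint
    interiors, which have the same volume.\<close>
  also have "\<dots> \<le> ennreal \<alpha> * emeasure lebesgue (\<Union>K\<in>D. interior K)"
  proof (rule emeasure_UN_le_disjoint[OF D(1)])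
    show "disjoint_family_on interior D"
      using D(3) by (auto simp: disjoint_family_on_def pairwise_def)
    fix K assume K: "K \<in> D"
    obtain c k where ck: "0 < k" "K = cube c k" using cubes[OF K] by auto
    obtain x where x: "x \<in> F" "x \<in> K" using D(4)[OF K] by auto
    have "emeasure (density lebesgue g) K = cube_int g c k"
      using ck by (simp add: cube_int_eq_emeasure)
    also have "\<dots> \<le> maxop g x * ennreal (k ^ CARD('n))"
      using ck x by (intro cube_int_le) auto
    also have "\<dots> \<le> ennreal \<alpha> * ennreal (k ^ CARD('n))"
      by (intro mult_right_mono le x) auto
    also have "ennreal (k ^ CARD('n)) = emeasure lebesgue (interior K)"
      using ck by (simp add: cube_def interior_cbox emeasure_completion emeasure_lborel_box_eq inner_add_left)
    finally show "emeasure (density lebesgue g) K \<le> ennreal \<alpha> * emeasure lebesgue (interior K)" .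
    show "K \<in> sets (density lebesgue g)" using ck by simp
  qed auto
  also have "\<dots> \<le> ennreal \<alpha> * emeasure lebesgue T"
    using sT interior_subset T(1) by (intro mult_left_mono emeasure_mono, blast) auto
  also have "emeasure lebesgue T \<le> emeasure lebesgue F + emeasure lebesgue (T - F)"
    using T by (intro order_trans[OF _ emeasure_subadditive] emeasure_mono) auto
  also have "\<dots> \<le> emeasure lebesgue F + ennreal d"
    using T by (intro add_left_mono) auto
  finally have "(\<integral>\<^sup>+ x \<in> F. g x \<partial>lebesgue) \<le> ennreal \<alpha> * (emeasure lebesgue F + ennreal d)"
    by (simp add: mult_left_mono)
  also have "\<dots> = ennreal \<alpha> * emeasure lebesgue F + ennreal (\<alpha> * d)"
    using \<alpha> d by (simp add: distrib_left ennreal_mult)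
  also have "\<dots> \<le> ennreal \<alpha> * emeasure lebesgue F + ennreal e"
    using d by (intro add_left_mono ennreal_leI) auto
  finally show "(\<integral>\<^sup>+ x \<in> F. g x \<partial>lebesgue) \<le> ennreal \<alpha> * emeasure lebesgue F + ennreal e" .
qed

text \<open>A stopping argument: almost every point with g > \<alpha> lies in a cube with average
  above \<alpha> of nearly maximal side. Its big cube then has average at most \<alpha>, so the
  integral over the big cubes of a disjoint subfamily is controlled by the measure of that
  subfamily, which lies inside the level set of \<open>maxop g\<close>.\<close>

lemma maxop_reverse_weak_type:
  fixes g :: "real^'n \<Rightarrow> ennreal"
  assumes g [measurable]: "g \<in> borel_measurable lebesgue"
    and supp: "\<And>y. y \<notin> cube a h \<Longrightarrow> g y = 0" and h: "0 < h" and \<alpha>: "0 < \<alpha>"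
    and small: "(\<integral>\<^sup>+ y. g y \<partial>lebesgue) \<le> ennreal (\<alpha> * h ^ CARD('n))"
  shows "(\<integral>\<^sup>+ y \<in> {y. ennreal \<alpha> < g y}. g y \<partial>lebesgue)
    \<le> ennreal ((10 * real CARD('n)) ^ CARD('n) * \<alpha>) *
       emeasure lebesgue {z \<in> cube (a - h *\<^sub>R One) (3 * h). ennreal \<alpha> < maxop g z}"
proof -
  let ?\<kappa> = "(10 * real CARD('n)) ^ CARD('n)"
  define F where "F = {y. ennreal \<alpha> < g y \<and> maxop g y \<le> ennreal \<alpha>}"
  define G where "G = {y. ennreal \<alpha> < g y \<and> ennreal \<alpha> < maxop g y}"
  have [measurable]: "F \<in> sets lebesgue" "G \<in> sets lebesgue"
  proof -
    have "{y \<in> space lebesgue. ennreal \<alpha> < g y \<and> maxop g y \<le> ennreal \<alpha>} \<in> sets lebesgue"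
      "{y \<in> space lebesgue. ennreal \<alpha> < g y \<and> ennreal \<alpha> < maxop g y} \<in> sets lebesgue"
      by measurable
    then show "F \<in> sets lebesgue" "G \<in> sets lebesgue" by (simp_all add: F_def G_def)
  qed
  have GQ: "y \<in> cube a h" if "y \<in> G" for y
    using supp[of y] that by (cases "y \<in> cube a h") (auto simp: G_def)
  have FQ: "F \<subseteq> cube a h" using supp by (force simp: F_def)
  have "emeasure lebesgue F \<le> emeasure lebesgue (cube a h)"
    using FQ by (intro emeasure_mono) auto
  then have Ffin: "emeasure lebesgue F < top"
    using h by (simp add: emeasure_cube order.strict_trans1)
  \<comment> \<open>F is negligible because its points violate the Lebesgue differentiation theorem.\<close>
  have F_le: "(\<integral>\<^sup>+ y \<in> F. g y \<partial>lebesgue) \<le> ennreal \<alpha> * emeasure lebesgue F"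
    by (rule set_nn_integral_le_of_maxop_le[OF g \<open>F \<in> sets lebesgue\<close> FQ h]) (use \<alpha> in \<open>auto simp: F_def\<close>)
  have "(\<integral>\<^sup>+ y \<in> F. g y \<partial>lebesgue) = (\<integral>\<^sup>+ y. ennreal \<alpha> * indicator F y + (g y - ennreal \<alpha>) * indicator F y \<partial>lebesgue)"
    by (intro nn_integral_cong) (auto simp: F_def split: split_indicator intro!: add_diff_inverse_ennreal[symmetric])
  also have "\<dots> = ennreal \<alpha> * emeasure lebesgue F + (\<integral>\<^sup>+ y \<in> F. (g y - ennreal \<alpha>) \<partial>lebesgue)"
    by (subst nn_integral_add) (auto simp: nn_integral_cmult)
  \<comment> \<open>By \<open>F_le\<close> the excess of \<open>g\<close> over \<alpha> integrates
    to 0 on F; the cancellation uses that F has finite measure.\<close>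
  finally have "ennreal \<alpha> * emeasure lebesgue F + (\<integral>\<^sup>+ y \<in> F. (g y - ennreal \<alpha>) \<partial>lebesgue)
      \<le> ennreal \<alpha> * emeasure lebesgue F + 0"
    using F_le by (simp only: add_0_right)
  then have "(\<integral>\<^sup>+ y \<in> F. (g y - ennreal \<alpha>) \<partial>lebesgue) = 0"
    using Ffin by (subst (asm) ennreal_add_left_cancel_le) (auto simp: ennreal_mult_eq_top_iff)
  then have "AE y in lebesgue. (g y - ennreal \<alpha>) * indicator F y = 0"
    by (subst (asm) nn_integral_0_iff_AE) auto
  then have "AE y in lebesgue. y \<notin> F"
    by eventually_elim (auto simp: F_def diff_eq_0_iff_ennreal split: split_indicator_asm)
  then have "AE y in lebesgue. g y * indicator {y. ennreal \<alpha> < g y} y = g y * indicator G y"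
    by eventually_elim (auto simp: F_def G_def split: split_indicator)
  then have eq: "(\<integral>\<^sup>+ y \<in> {y. ennreal \<alpha> < g y}. g y \<partial>lebesgue) = emeasure (density lebesgue g) G"
    by (simp add: emeasure_density nn_integral_cong_AE)

  \<comment> \<open>Side lengths are collected instead of cubes so that a supremum can be taken;
    \<open>small\<close> keeps them all below \<open>h\<close>.\<close>
  define L where "L y = {l. 0 < l \<and> (\<exists>b. y \<in> cube b l \<and> ennreal \<alpha> * ennreal (l ^ CARD('n)) < cube_int g b l)}" for y
  have L: "l < h" if lL: "l \<in> L y" for l y
  proof -
    obtain b where "0 < l" "ennreal \<alpha> * ennreal (l ^ CARD('n)) < cube_int g b l"
      using lL by (auto simp: L_def)
    then have "ennreal (\<alpha> * l ^ CARD('n)) < ennreal (\<alpha> * h ^ CARD('n))"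
      using cube_int_le_nn_integral[of g b l] small \<alpha> by (auto simp: ennreal_mult)
    then have "l ^ CARD('n) < h ^ CARD('n)" using \<alpha> \<open>0 < l\<close> by (simp add: ennreal_less_iff)
    then show ?thesis using h by (rule power_less_imp_less_base[OF _ less_imp_le])
  qed
  \<comment> \<open>Cubes of almost maximal size: enlarging by a factor 2 pushes the average below \<open>\<alpha>\<close>.\<close>
  have "\<exists>b l. l \<in> L y \<and> y \<in> cube b l \<and> ennreal \<alpha> * ennreal (l ^ CARD('n)) < cube_int g b l
      \<and> (\<forall>t\<ge>2 * l. t \<notin> L y)" if "y \<in> G" for y
  proof -
    have ne: "L y \<noteq> {}" using that by (auto simp: G_def less_maxop_iff L_def)
    have bdd: "bdd_above (L y)" using L by (intro bdd_aboveI[of _ h]) (auto intro: less_imp_le)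
    obtain l0 where "l0 \<in> L y" using ne by auto
    then have "0 < Sup (L y)" using cSup_upper[OF _ bdd, of l0] by (auto simp: L_def)
    then have "Sup (L y) / 2 < Sup (L y)" by simp
    then obtain l where l: "l \<in> L y" "Sup (L y) / 2 < l"
      using less_cSup_iff[OF ne bdd] by blast
    moreover have "t \<notin> L y" if "t \<ge> 2 * l" for t
      using cSup_upper[OF _ bdd, of t] that l(2) by auto
    ultimately show ?thesis by (auto simp: L_def)
  qed
  then obtain b l where bl: "\<And>y. y \<in> G \<Longrightarrow> l y \<in> L y" "\<And>y. y \<in> G \<Longrightarrow> y \<in> cube (b y) (l y)"
    "\<And>y. y \<in> G \<Longrightarrow> ennreal \<alpha> * ennreal (l y ^ CARD('n)) < cube_int g (b y) (l y)"
    "\<And>y t. y \<in> G \<Longrightarrow> 2 * l y \<le> t \<Longrightarrow> t \<notin> L y"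
    by metis
  have l: "0 < l y \<and> l y \<le> h" if "y \<in> G" for y
    using bl(1)[OF that] L[of "l y" y] by (auto simp: L_def)
  obtain C where C: "countable C" "C \<subseteq> G" "disjoint_family_on (\<lambda>y. cube (b y) (l y)) C"
    "(\<Union>y\<in>G. cube (b y) (l y)) \<subseteq> (\<Union>y\<in>C. big_cube (b y) (l y))"
    using cube_Vitali[of G l h b] l by blast
  have "emeasure (density lebesgue g) G \<le> emeasure (density lebesgue g) (\<Union>y\<in>C. big_cube (b y) (l y))"
    using C bl(2) by (intro emeasure_mono sets.countable_UN') (auto, blast)
  also have "\<dots> \<le> ennreal (?\<kappa> * \<alpha>) * emeasure lebesgue (\<Union>y\<in>C. cube (b y) (l y))"
  proof (rule emeasure_UN_le_disjoint[OF C(1) _ _ C(3)])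
    fix y assume "y \<in> C"
    then have y: "y \<in> G" using C by auto
    let ?l = "10 * real CARD('n) * l y"
      and ?b = "b y + (l y / 2 - 5 * real CARD('n) * l y) *\<^sub>R One"
    \<comment> \<open>The side of the big cube is at least twice \<open>l y\<close>, hence beyond
      the stopping size.\<close>
    have "2 \<le> 10 * real CARD('n)" using CARD_ge_1[where 'n='n] by linarith
    then have "2 * l y \<le> ?l" using l[OF y] by (intro mult_right_mono) auto
    then have "?l \<notin> L y" "0 < ?l" using bl(4)[OF y] l[OF y] by auto
    moreover have "y \<in> cube ?b ?l"
      using cube_subset_big_cube[of "l y" "b y"] bl(2)[OF y] l[OF y] by (auto simp: big_cube_def)
    ultimately have "cube_int g ?b ?l \<le> ennreal \<alpha> * ennreal (?l ^ CARD('n))"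
      by (auto simp: L_def not_less)
    also have "\<dots> = ennreal (?\<kappa> * \<alpha>) * emeasure lebesgue (cube (b y) (l y))"
      using l[OF y] \<alpha> by (simp add: emeasure_cube power_mult_distrib mult_ac flip: ennreal_mult)
    finally show "emeasure (density lebesgue g) (big_cube (b y) (l y))
        \<le> ennreal (?\<kappa> * \<alpha>) * emeasure lebesgue (cube (b y) (l y))"
      by (simp add: big_cube_def cube_int_eq_emeasure)
  qed auto
  also have "emeasure lebesgue (\<Union>y\<in>C. cube (b y) (l y))
      \<le> emeasure lebesgue {z \<in> cube (a - h *\<^sub>R One) (3 * h). ennreal \<alpha> < maxop g z}"
  proof (intro emeasure_mono UN_least subsetI)
    fix y z assume yz: "y \<in> C" "z \<in> cube (b y) (l y)"
    then have y: "y \<in> G" using C by auto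
    have "ennreal \<alpha> < maxop g z" using bl(3)[OF y] l[OF y] yz by (auto simp: less_maxop_iff)
    moreover have "z \<in> cube (a - h *\<^sub>R One) (3 * h)"
      unfolding mem_cube
    proof
      fix i
      show "(a - h *\<^sub>R One) $ i \<le> z $ i \<and> z $ i \<le> (a - h *\<^sub>R One) $ i + 3 * h"
        using yz(2) bl(2)[OF y] GQ[OF y] l[OF y] by (auto simp: mem_cube dest!: spec[of _ i])
    qed
    ultimately show "z \<in> {z \<in> cube (a - h *\<^sub>R One) (3 * h). ennreal \<alpha> < maxop g z}" by simp
  qed measurable
  finally show ?thesis unfolding eq by (simp add: mult_left_mono)
qed

section \<open>The L log L estimate\<close>

text \<open>A geometric sum is at most twice its last term, and the last level counted is below
  m.\<close>

lemma sum_levels_le: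
  fixes m :: ennreal
  assumes "0 \<le> A"
  shows "(\<Sum>k<K. ennreal (2 ^ k * A) * of_bool (ennreal (2 ^ k * A) < m)) \<le> 2 * m"
proof (induction K)
  case (Suc K)
  show ?case
  proof (cases "ennreal (2 ^ K * A) < m")
    case True
    have "(\<Sum>k<Suc K. ennreal (2 ^ k * A) * of_bool (ennreal (2 ^ k * A) < m)) \<le> (\<Sum>k<Suc K. ennreal (2 ^ k * A))"
      by (intro sum_mono) simp
    also have "\<dots> = ennreal ((\<Sum>k<Suc K. 2 ^ k) * A)"
      using assms by (simp add: sum_ennreal sum_distrib_right del: sum.lessThan_Suc)
    also have "\<dots> \<le> ennreal (2 * (2 ^ K * A))"
    proof (intro ennreal_leI)
      have "(\<Sum>k<Suc K. 2 ^ k) \<le> 2 * (2 ^ K :: real)" by (induction K) auto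
      from mult_right_mono[OF this assms] show "(\<Sum>k<Suc K. 2 ^ k) * A \<le> 2 * (2 ^ K * A)" by (simp add: mult_ac)
    qed
    also have "\<dots> = 2 * ennreal (2 ^ K * A)" using assms by (simp add: ennreal_mult)
    also have "\<dots> \<le> 2 * m" using True by (intro mult_left_mono) auto
    finally show ?thesis .
  qed (use Suc in simp)
qed simp

text \<open>The bound on the measure of E is chosen so that, on each of the K levels, the values
  below the level carry at most half of the integral over E. Each level thus accounts for half of
  that integral, while all levels together cost only a multiple of the integral of
  \<open>maxop g\<close> over the triple cube.\<close>

lemma set_nn_integral_small_set_le:
  fixes g :: "real^'n \<Rightarrow> ennreal"
  assumes g [measurable]: "g \<in> borel_measurable lebesgue" and E [measurable]: "E \<in> sets lebesgue"
    and sub: "E \<subseteq> cube a h" and h: "0 < h" and x: "x \<in> cube a h"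
    and small: "emeasure lebesgue E \<le> ennreal (1 / 2 ^ Suc K) * ennreal (h ^ CARD('n))"
  shows "ennreal (real K) * (\<integral>\<^sup>+ y \<in> E. g y \<partial>lebesgue)
    \<le> ennreal (4 * (30 * real CARD('n)) ^ CARD('n)) * (ennreal (h ^ CARD('n)) * maxop (maxop g) x)"
proof -
  let ?\<kappa> = "(10 * real CARD('n)) ^ CARD('n)" and ?Q3 = "cube (a - h *\<^sub>R One) (3 * h)"
  define g0 where "g0 y = g y * indicator E y" for y
  have [measurable]: "g0 \<in> borel_measurable lebesgue" unfolding g0_def by measurable
  have g0_le: "g0 y \<le> g y" for y by (auto simp: g0_def split: split_indicator)
  have I_def: "(\<integral>\<^sup>+ y \<in> E. g y \<partial>lebesgue) = (\<integral>\<^sup>+ y. g0 y \<partial>lebesgue)" by (simp add: g0_def)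
  have Qsub: "cube a h \<subseteq> ?Q3" using h by (intro cube_subsetI) auto
  show ?thesis
  proof (cases "(\<integral>\<^sup>+ y. g0 y \<partial>lebesgue) = top")
    case True
    \<comment> \<open>An infinite integral makes \<open>maxop g\<close> infinite on the whole cube,
      hence \<open>maxop (maxop g)\<close> infinite at x.\<close>
    have "top \<le> cube_int g a h" unfolding True[symmetric] cube_int_def using sub
      by (intro nn_integral_mono) (auto simp: g0_def split: split_indicator)
    then have "maxop g z = top" if "z \<in> cube a h" for z
      using cube_int_le[OF h that, of g] h by (auto simp: top_unique ennreal_mult_eq_top_iff)
    then have "cube_int (maxop g) a h = (\<integral>\<^sup>+ y. top * indicator (cube a h) y \<partial>lebesgue)"
      unfolding cube_int_def by (intro nn_integral_cong) (auto split: split_indicator)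
    also have "\<dots> = top" using h by (subst nn_integral_cmult_indicator) (auto simp: emeasure_cube ennreal_top_mult)
    finally have "maxop (maxop g) x = top"
      using cube_int_le[OF h x, of "maxop g"] by (auto simp: top_unique ennreal_mult_eq_top_iff)
    then show ?thesis using h by (simp add: ennreal_mult_top)
  next
    case False
    then obtain I where I: "(\<integral>\<^sup>+ y. g0 y \<partial>lebesgue) = ennreal I" "0 \<le> I"
      by (cases "(\<integral>\<^sup>+ y. g0 y \<partial>lebesgue)") auto
    show ?thesis
    proof (cases "I = 0")
      case True then show ?thesis by (simp add: I_def I)
    next
      case False
      \<comment> \<open>The average of \<open>g0\<close> over the cube. Levels 2^k A are at least A,
        which is what the hypothesis \<open>small\<close> of \<open>maxop_reverse_weak_type\<close>
        demands.\<close>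
      define A where "A = I / h ^ CARD('n)"
      have A: "0 < A" "A * h ^ CARD('n) = I" using False I h by (auto simp: A_def)
      let ?m = "\<lambda>k. emeasure lebesgue {z \<in> ?Q3. ennreal (2 ^ k * A) < maxop g0 z}"
      have level: "ennreal (I / 2) \<le> ennreal ?\<kappa> * (ennreal (2 ^ k * A) * ?m k)" if "k < K" for k
      proof -
        let ?\<alpha> = "2 ^ k * A"
        let ?X = "\<integral>\<^sup>+ y \<in> {y. ennreal ?\<alpha> < g0 y}. g0 y \<partial>lebesgue"
        have "ennreal I = (\<integral>\<^sup>+ y. g0 y * indicator {y. ennreal ?\<alpha> < g0 y} y + g0 y * indicator {y. g0 y \<le> ennreal ?\<alpha>} y \<partial>lebesgue)"
          unfolding I(1)[symmetric] by (intro nn_integral_cong) (auto split: split_indicator)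
        also have "\<dots> = ?X + (\<integral>\<^sup>+ y \<in> {y. g0 y \<le> ennreal ?\<alpha>}. g0 y \<partial>lebesgue)"
          by (intro nn_integral_add) auto
        \<comment> \<open>The part below the level is at most the level times the measure of E, and
          this is at most I / 2 because k < K.\<close>
        also have "(\<integral>\<^sup>+ y \<in> {y. g0 y \<le> ennreal ?\<alpha>}. g0 y \<partial>lebesgue) \<le> (\<integral>\<^sup>+ y. ennreal ?\<alpha> * indicator E y \<partial>lebesgue)"
          by (intro nn_integral_mono) (auto simp: g0_def split: split_indicator)
        also have "\<dots> = ennreal ?\<alpha> * emeasure lebesgue E" by (simp add: nn_integral_cmult)
        also have "\<dots> \<le> ennreal ?\<alpha> * (ennreal (1 / 2 ^ Suc K) * ennreal (h ^ CARD('n)))"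
          by (intro mult_left_mono small) auto
        also have "\<dots> = ennreal (2 ^ k / 2 ^ Suc K * I)"
          using A h by (simp add: A(2)[symmetric] mult_ac flip: ennreal_mult)
        also have "\<dots> \<le> ennreal (1 / 2 * I)"
        proof (intro ennreal_leI mult_right_mono)
          have "(2::real) ^ k \<le> 2 ^ K" using that by (intro power_increasing) auto
          then show "2 ^ k / 2 ^ Suc K \<le> (1 / 2 :: real)" by (simp add: field_simps)
        qed (use I in auto)
        finally have "ennreal I \<le> ?X + ennreal (I / 2)" by (simp add: add_left_mono)
        moreover have "ennreal I = ennreal (I / 2) + ennreal (I / 2)"
          using I by (simp flip: ennreal_plus)
        ultimately have "ennreal (I / 2) \<le> ?X"
          by (simp add: add.commute ennreal_add_left_cancel_le)
        also have "?X \<le> ennreal (?\<kappa> * ?\<alpha>) * ?m k"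
        proof (rule maxop_reverse_weak_type)
          show "g0 y = 0" if "y \<notin> cube a h" for y using that sub by (auto simp: g0_def split: split_indicator)
          have "1 * A \<le> 2 ^ k * A" using A by (intro mult_right_mono) auto
          then show "(\<integral>\<^sup>+ y. g0 y \<partial>lebesgue) \<le> ennreal (2 ^ k * A * h ^ CARD('n))"
            unfolding I A(2)[symmetric] using h by (intro ennreal_leI mult_right_mono) auto
        qed (use h A in auto)
        also have "\<dots> = ennreal ?\<kappa> * (ennreal ?\<alpha> * ?m k)"
          using A by (simp add: ennreal_mult mult_ac)
        finally show ?thesis .
      qed
      \<comment> \<open>Summing under the integral sign lets \<open>sum_levels_le\<close> act
        pointwise.\<close>
      have "(\<Sum>k<K. ennreal (2 ^ k * A) * ?m k)
          = (\<integral>\<^sup>+ z. (\<Sum>k<K. ennreal (2 ^ k * A) * indicator {z \<in> ?Q3. ennreal (2 ^ k * A) < maxop g0 z} z) \<partial>lebesgue)"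
        by (subst nn_integral_sum) (auto intro!: sum.cong simp: nn_integral_cmult)
      also have "\<dots> \<le> (\<integral>\<^sup>+ z. 2 * (maxop g z * indicator ?Q3 z) \<partial>lebesgue)"
      proof (intro nn_integral_mono)
        fix z
        have "(\<Sum>k<K. ennreal (2 ^ k * A) * of_bool (ennreal (2 ^ k * A) < maxop g0 z)) \<le> 2 * maxop g z"
          using sum_levels_le[where A = A and K = K and m = "maxop g0 z"] A maxop_mono[of g0 g z, OF g0_le]
          by (meson less_imp_le mult_left_mono order_trans zero_le)
        then show "(\<Sum>k<K. ennreal (2 ^ k * A) * indicator {z \<in> ?Q3. ennreal (2 ^ k * A) < maxop g0 z} z)
            \<le> 2 * (maxop g z * indicator ?Q3 z)"
          by (cases "z \<in> ?Q3") (auto simp: indicator_def)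
      qed
      also have "\<dots> = 2 * cube_int (maxop g) (a - h *\<^sub>R One) (3 * h)"
        unfolding cube_int_def by (intro nn_integral_cmult) auto
      also have "\<dots> \<le> 2 * (maxop (maxop g) x * ennreal ((3 * h) ^ CARD('n)))"
        using h x Qsub by (intro mult_left_mono cube_int_le) auto
      finally have levels: "(\<Sum>k<K. ennreal (2 ^ k * A) * ?m k) \<le> 2 * (maxop (maxop g) x * ennreal ((3 * h) ^ CARD('n)))" .
      have "ennreal (real K) * ennreal I = 2 * (\<Sum>k<K. ennreal (I / 2))"
      proof -
        have "(\<Sum>k<K. ennreal (I / 2)) = ennreal (real K * (I / 2))"
          using I by (subst sum_ennreal) auto
        moreover have "2 * ennreal (real K * (I / 2)) = ennreal (2 * (real K * (I / 2)))"
          using I by (subst ennreal_mult) auto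
        ultimately show ?thesis using I by (simp flip: ennreal_mult)
      qed
      also have "\<dots> \<le> 2 * (\<Sum>k<K. ennreal ?\<kappa> * (ennreal (2 ^ k * A) * ?m k))"
        by (intro mult_left_mono sum_mono level) auto
      also have "\<dots> = ennreal (2 * ?\<kappa>) * (\<Sum>k<K. ennreal (2 ^ k * A) * ?m k)"
        by (simp add: sum_distrib_left ennreal_mult mult.assoc)
      also have "\<dots> \<le> ennreal (2 * ?\<kappa>) * (2 * (maxop (maxop g) x * ennreal ((3 * h) ^ CARD('n))))"
        by (intro mult_left_mono levels) auto
      also have "\<dots> = ennreal (4 * (30 * real CARD('n)) ^ CARD('n)) * (ennreal (h ^ CARD('n)) * maxop (maxop g) x)"
      proof -
        \<comment> \<open>One factor 2 comes from halving the integral, the other from the geometric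
          sum, (10 n)^n from the reverse weak type inequality and 3^n from the triple.\<close>
        have eq: "2 * ?\<kappa> * 2 * (3 * h) ^ CARD('n) = 4 * (30 * real CARD('n)) ^ CARD('n) * h ^ CARD('n)"
        proof -
          have "?\<kappa> * (3 * h) ^ CARD('n) = (30 * real CARD('n)) ^ CARD('n) * h ^ CARD('n)"
            by (simp only: power_mult_distrib[symmetric]) (simp add: mult_ac)
          then show ?thesis by linarith
        qed
        have "ennreal (2 * ?\<kappa>) * (2 * (m * ennreal ((3 * h) ^ CARD('n))))
            = ennreal (2 * ?\<kappa> * 2 * (3 * h) ^ CARD('n)) * m" for m
          using h by (simp add: ennreal_mult mult_ac)
        then show ?thesis unfolding eq using h by (subst (asm) ennreal_mult) (auto simp: mult.assoc)
      qed
      finally show ?thesis by (simp add: I_def I)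
    qed
  qed
qed

section \<open>Pointwise comparison with the local maximal operator\<close>

text \<open>On a cube, split |f| at an admissible level \<alpha> of the rearrangement. The part
  below adds at most \<alpha> to the average; the set above has measure at most |Q| / 2^(K+1), so
  the L log L estimate bounds its contribution with a gain of 1/K.\<close>

lemma M_le_local_maxop_plus:
  fixes f :: "real^'n \<Rightarrow> real"
  assumes f [measurable]: "f \<in> borel_measurable lebesgue" and K: "0 < K"
  shows "M f x \<le> local_maxop (1 / 2 ^ Suc K) f x
    + ennreal (4 * (30 * real CARD('n)) ^ CARD('n) / real K) * maxop (M f) x"
  unfolding maxop_le_iff[of _ x]
proof (intro allI impI)
  fix a :: "real^'n" and h :: real assume h: "0 < h" and x: "x \<in> cube a h"
  let ?D = "4 * (30 * real CARD('n)) ^ CARD('n)" and ?lam = "1 / 2 ^ Suc K :: real"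
  let ?hn = "ennreal (h ^ CARD('n))"
  define R where "R = ennreal (?D / real K) * maxop (M f) x"
  define v where "v = cube_int (\<lambda>y. ennreal \<bar>f y\<bar>) a h / ?hn"
  have hn: "0 < h ^ CARD('n)" using h by simp
  have "v \<le> local_rearr ?lam f (cube a h) + R"
  proof (cases "R = top")
    case False
    \<comment> \<open>R is moved to the left so that the bound for each \<alpha> passes to the
      infimum.\<close>
    have "v - R \<le> local_rearr ?lam f (cube a h)"
      unfolding local_rearr_def
    proof (rule Inf_greatest, clarify)
      fix \<alpha> :: real assume \<alpha>: "0 < \<alpha>"
        and E: "emeasure lebesgue {y \<in> cube a h. \<alpha> < \<bar>f y\<bar>} \<le> ennreal ?lam * emeasure lebesgue (cube a h)"
      let ?E = "{y \<in> cube a h. \<alpha> < \<bar>f y\<bar>}"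
      have "cube_int (\<lambda>y. ennreal \<bar>f y\<bar>) a h
          \<le> (\<integral>\<^sup>+ y. ennreal \<alpha> * indicator (cube a h) y + ennreal \<bar>f y\<bar> * indicator ?E y \<partial>lebesgue)"
        unfolding cube_int_def
        by (intro nn_integral_mono) (auto split: split_indicator intro!: ennreal_leI)
      also have "\<dots> = ennreal \<alpha> * emeasure lebesgue (cube a h) + (\<integral>\<^sup>+ y \<in> ?E. ennreal \<bar>f y\<bar> \<partial>lebesgue)"
        by (subst nn_integral_add) (auto simp: nn_integral_cmult)
      also have "emeasure lebesgue (cube a h) = ?hn" using h by (simp add: emeasure_cube)
      also have "(\<integral>\<^sup>+ y \<in> ?E. ennreal \<bar>f y\<bar> \<partial>lebesgue)
          = ennreal (1 / real K) * (ennreal (real K) * (\<integral>\<^sup>+ y \<in> ?E. ennreal \<bar>f y\<bar> \<partial>lebesgue))"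
        using K by (simp add: mult.assoc[symmetric] flip: ennreal_mult)
      also have "\<dots> \<le> ennreal (1 / real K) * (ennreal ?D * (?hn * maxop (M f) x))"
        using E h by (intro mult_left_mono set_nn_integral_small_set_le[OF _ _ _ h x]) (auto simp: emeasure_cube)
      also have "\<dots> = R * ?hn"
        unfolding R_def using K by (simp add: mult.assoc[symmetric] flip: ennreal_mult) (simp add: mult_ac)
      finally have "cube_int (\<lambda>y. ennreal \<bar>f y\<bar>) a h \<le> (ennreal \<alpha> + R) * ?hn"
        by (simp add: distrib_right add_left_mono)
      then have "v \<le> ennreal \<alpha> + R" unfolding v_def using hn by (simp add: ennreal_le_divide_pos)
      then show "v - R \<le> ennreal \<alpha>"
        using False by (simp add: ennreal_minus_le_iff add.commute)
    qed
    then have "v - R + R \<le> local_rearr ?lam f (cube a h) + R" by (rule add_right_mono)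
    moreover have "v \<le> v - R + R" by (auto simp: diff_add_self_ennreal)
    ultimately show ?thesis by (rule order_trans[rotated])
  qed simp
  also have "local_rearr ?lam f (cube a h) \<le> local_maxop ?lam f x"
    unfolding local_maxop_def using h x by (intro SUP_upper) auto
  finally have "v \<le> local_maxop ?lam f x + R" by (simp add: add_right_mono)
  then show "cube_int (\<lambda>y. ennreal \<bar>f y\<bar>) a h
      \<le> (local_maxop ?lam f x + ennreal (?D / real K) * maxop (M f) x) * ?hn"
    unfolding v_def R_def using hn by (simp add: ennreal_le_divide_pos)
qed

text \<open>A cube through a point of Q with average above the level must be smaller than Q, since
  otherwise its triple would contain x; this costs the term 3^n. Smaller cubes see \<open>g\<close>
  only on the triple of Q, where the weak type inequality bounds the level set by lam |Q|; this
  costs (30 n)^n / lam.\<close>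

lemma local_maxop_maxop_le:
  fixes g :: "real^'n \<Rightarrow> ennreal"
  assumes g [measurable]: "g \<in> borel_measurable lebesgue" and lam: "0 < lam"
  shows "local_maxop lam (\<lambda>y. enn2real (maxop g y)) x
    \<le> ennreal ((30 * real CARD('n)) ^ CARD('n) / lam + 3 ^ CARD('n)) * maxop g x"
  unfolding local_maxop_def
proof (rule SUP_least, clarify)
  let ?\<kappa> = "(10 * real CARD('n)) ^ CARD('n)"
  let ?\<kappa>3 = "(30 * real CARD('n)) ^ CARD('n)"
  let ?C = "?\<kappa>3 / lam + 3 ^ CARD('n)"
  fix a :: "real^'n" and h :: real assume h: "0 < h" and x: "x \<in> cube a h"
  let ?Q3 = "cube (a - h *\<^sub>R One) (3 * h)"
  show "local_rearr lam (\<lambda>y. enn2real (maxop g y)) (cube a h) \<le> ennreal ?C * maxop g x"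
  proof (rule ennreal_le_epsilon)
    fix e :: real assume e: "0 < e" and "ennreal ?C * maxop g x < top"
    then obtain r where r: "ennreal ?C * maxop g x = ennreal r" "0 \<le> r"
      by (cases "ennreal ?C * maxop g x") auto
    \<comment> \<open>Adding \<open>e\<close> makes the level positive even if
      \<open>maxop g x\<close> is 0.\<close>
    define \<alpha> where "\<alpha> = r + e"
    have \<alpha>: "0 < \<alpha>" "ennreal ?C * maxop g x \<le> ennreal \<alpha>"
      using r e by (auto simp: \<alpha>_def intro!: ennreal_leI)
    have \<alpha>1: "ennreal (3 ^ CARD('n)) * maxop g x \<le> ennreal \<alpha>"
      using lam by (intro order_trans[OF mult_right_mono \<alpha>(2)] ennreal_leI) auto
    have "ennreal ?\<kappa>3 * maxop g x = ennreal lam * (ennreal (?\<kappa>3 / lam) * maxop g x)"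
      using lam by (simp add: mult.assoc[symmetric] flip: ennreal_mult)
    also have "\<dots> \<le> ennreal lam * (ennreal ?C * maxop g x)"
      using lam by (intro mult_left_mono mult_right_mono ennreal_leI) auto
    also have "\<dots> \<le> ennreal lam * ennreal \<alpha>" by (intro mult_left_mono \<alpha>) auto
    finally have \<alpha>2: "ennreal ?\<kappa>3 * maxop g x \<le> ennreal lam * ennreal \<alpha>" .
    define g3 where "g3 y = g y * indicator ?Q3 y" for y
    have [measurable]: "g3 \<in> borel_measurable lebesgue" unfolding g3_def by measurable
    have sub: "{y \<in> cube a h. \<bar>enn2real (maxop g y)\<bar> > \<alpha>} \<subseteq> {y. ennreal \<alpha> < maxop g3 y}"
    proof clarsimp
      fix y assume y: "y \<in> cube a h" "\<alpha> < enn2real (maxop g y)"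
      \<comment> \<open>Where \<open>maxop g y\<close> is infinite, \<open>enn2real\<close> returns
        0, so such a y is not in the set considered.\<close>
      have "ennreal \<alpha> < maxop g y"
      proof (cases "maxop g y")
        case (real s) then show ?thesis using y \<alpha> by (simp add: ennreal_less_iff)
      qed (use \<alpha> y in auto)
      then obtain b l where bl: "0 < l" "y \<in> cube b l" "ennreal \<alpha> * ennreal (l ^ CARD('n)) < cube_int g b l"
        by (auto simp: less_maxop_iff)
      have near: "b $ i \<le> y $ i" "y $ i \<le> b $ i + l" "a $ i \<le> y $ i" "y $ i \<le> a $ i + h"
        "a $ i \<le> x $ i" "x $ i \<le> a $ i + h" for i
        using bl(2) y(1) x by (auto simp: mem_cube)
      have "l < h"
      proof (rule ccontr)
        assume "\<not> l < h"
        \<comment> \<open>Both x and y lie in the cube of side h, and h is at most l here, so x is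
          within l of y in every coordinate.\<close>
        have "x \<in> cube (b - l *\<^sub>R One) (3 * l)" unfolding mem_cube
        proof
          fix i show "(b - l *\<^sub>R One) $ i \<le> x $ i \<and> x $ i \<le> (b - l *\<^sub>R One) $ i + 3 * l"
            using near[of i] \<open>\<not> l < h\<close> by auto
        qed
        then have "cube_int g (b - l *\<^sub>R One) (3 * l) \<le> maxop g x * ennreal ((3 * l) ^ CARD('n))"
          using bl(1) by (intro cube_int_le) auto
        moreover have "cube_int g b l \<le> cube_int g (b - l *\<^sub>R One) (3 * l)"
          using bl(1) by (intro cube_int_mono cube_subsetI) auto
        ultimately have "cube_int g b l \<le> maxop g x * ennreal ((3 * l) ^ CARD('n))" by (rule order_trans[rotated])
        also have "\<dots> = ennreal (3 ^ CARD('n)) * maxop g x * ennreal (l ^ CARD('n))"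
          using bl(1) by (simp add: power_mult_distrib ennreal_mult mult_ac)
        also have "\<dots> \<le> ennreal \<alpha> * ennreal (l ^ CARD('n))" by (intro mult_right_mono \<alpha>1) auto
        finally show False using bl(3) by simp
      qed
      have "cube b l \<subseteq> ?Q3"
      proof (rule cube_subsetI)
        fix i show "(a - h *\<^sub>R One) $ i \<le> b $ i" "b $ i + l \<le> (a - h *\<^sub>R One) $ i + 3 * h"
          using near[of i] \<open>l < h\<close> by auto
      qed
      then have "cube_int g b l = cube_int g3 b l"
        unfolding cube_int_def g3_def by (intro nn_integral_cong) (auto split: split_indicator)
      then show "ennreal \<alpha> < maxop g3 y" using bl by (auto simp: less_maxop_iff)
    qed
    have "ennreal \<alpha> * emeasure lebesgue {y. ennreal \<alpha> < maxop g3 y}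
        \<le> ennreal ?\<kappa> * (\<integral>\<^sup>+ y. g3 y \<partial>lebesgue)"
      by (rule maxop_weak_type) (use \<alpha> in auto)
    also have "(\<integral>\<^sup>+ y. g3 y \<partial>lebesgue) = cube_int g (a - h *\<^sub>R One) (3 * h)"
      by (simp add: g3_def cube_int_def)
    also have "ennreal ?\<kappa> * cube_int g (a - h *\<^sub>R One) (3 * h)
        \<le> ennreal ?\<kappa> * (maxop g x * ennreal ((3 * h) ^ CARD('n)))"
      using h x cube_subsetI[of "a - h *\<^sub>R One" a h "3 * h"] by (intro mult_left_mono cube_int_le) auto
    also have "\<dots> = ennreal ?\<kappa>3 * maxop g x * ennreal (h ^ CARD('n))"
    proof -
      have "?\<kappa>3 = ?\<kappa> * 3 ^ CARD('n)" by (simp only: power_mult_distrib[symmetric]) (simp add: mult_ac)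
      then show ?thesis using h by (simp add: power_mult_distrib[of 3] ennreal_mult mult_ac)
    qed
    also have "\<dots> \<le> ennreal lam * ennreal \<alpha> * ennreal (h ^ CARD('n))"
      by (intro mult_right_mono \<alpha>2) auto
    also have "\<dots> = ennreal \<alpha> * (ennreal lam * emeasure lebesgue (cube a h))"
      using h by (simp add: emeasure_cube mult_ac)
    finally have "emeasure lebesgue {y. ennreal \<alpha> < maxop g3 y} \<le> ennreal lam * emeasure lebesgue (cube a h)"
      using \<alpha> by (subst (asm) ennreal_mult_le_mult_iff) auto
    moreover have "emeasure lebesgue {y \<in> cube a h. \<bar>enn2real (maxop g y)\<bar> > \<alpha>}
        \<le> emeasure lebesgue {y. ennreal \<alpha> < maxop g3 y}"
      using sub open_less_maxop[of "ennreal \<alpha>" g3] by (intro emeasure_mono) (auto simp: borel_open)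
    ultimately have "local_rearr lam (\<lambda>y. enn2real (maxop g y)) (cube a h) \<le> ennreal \<alpha>"
      unfolding local_rearr_def using \<alpha> by (intro Inf_lower) auto
    also have "\<dots> = ennreal ?C * maxop g x + ennreal e"
      using r e by (simp add: \<alpha>_def)
    finally show "local_rearr lam (\<lambda>y. enn2real (maxop g y)) (cube a h) \<le> ennreal ?C * maxop g x + ennreal e" .
  qed
qed

section \<open>Monotonicity, monotone limits and decay, for the passage to general functions\<close>

lemma local_maxop_mono:
  fixes f g :: "real^'n \<Rightarrow> real"
  assumes [measurable]: "g \<in> borel_measurable lebesgue" and le: "\<And>y. \<bar>f y\<bar> \<le> \<bar>g y\<bar>"
  shows "local_maxop lam f x \<le> local_maxop lam g x"
proof -
  have "local_rearr lam f (cube a h) \<le> local_rearr lam g (cube a h)" for a h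
    unfolding local_rearr_def
  proof (intro Inf_superset_mono Collect_mono ex_mono impI, elim conjE, intro conjI)
    fix \<alpha> :: real
    assume "emeasure lebesgue {y \<in> cube a h. \<alpha> < \<bar>g y\<bar>} \<le> ennreal lam * emeasure lebesgue (cube a h)"
    moreover have "emeasure lebesgue {y \<in> cube a h. \<alpha> < \<bar>f y\<bar>} \<le> emeasure lebesgue {y \<in> cube a h. \<alpha> < \<bar>g y\<bar>}"
      using le by (intro emeasure_mono) (auto intro: less_le_trans)
    ultimately show "emeasure lebesgue {y \<in> cube a h. \<alpha> < \<bar>f y\<bar>} \<le> ennreal lam * emeasure lebesgue (cube a h)"
      by simp
  qed
  then show ?thesis unfolding local_maxop_def by (intro SUP_mono) auto
qed

text \<open>Monotone convergence on each cube, followed by an exchange of two suprema.\<close>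

lemma maxop_SUP:
  fixes F :: "nat \<Rightarrow> real^'n \<Rightarrow> ennreal"
  assumes [measurable]: "\<And>j. F j \<in> borel_measurable lebesgue" and inc: "\<And>y. incseq (\<lambda>j. F j y)"
  shows "maxop (\<lambda>y. SUP j. F j y) x = (SUP j. maxop (F j) x)"
proof -
  have "cube_int (\<lambda>y. SUP j. F j y) a h = (SUP j. cube_int (F j) a h)" for a h
  proof -
    have "cube_int (\<lambda>y. SUP j. F j y) a h = (\<integral>\<^sup>+ y. (SUP j. F j y * indicator (cube a h) y) \<partial>lebesgue)"
      unfolding cube_int_def by (simp add: SUP_mult_right_ennreal)
    also have "\<dots> = (SUP j. cube_int (F j) a h)"
      unfolding cube_int_def using inc
      by (intro nn_integral_monotone_convergence_SUP) (auto simp: incseq_def le_fun_def intro!: mult_right_mono)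
    finally show ?thesis .
  qed
  then have eq: "(\<integral>\<^sup>+ y \<in> cube a h. (SUP j. F j y) \<partial>lebesgue) = (SUP j. \<integral>\<^sup>+ y \<in> cube a h. F j y \<partial>lebesgue)" for a h
    by (simp add: cube_int_def)
  have "maxop (\<lambda>y. SUP j. F j y) x = (SUP Q \<in> {cube a h | a h. h > 0 \<and> x \<in> cube a h}.
       (SUP j. (\<integral>\<^sup>+ y \<in> Q. F j y \<partial>lebesgue) / emeasure lebesgue Q))"
    unfolding maxop_def by (intro SUP_cong refl) (auto simp: eq SUP_divide_ennreal)
  also have "\<dots> = (SUP j. maxop (F j) x)"
    unfolding maxop_def by (rule SUP_commute)
  finally show ?thesis .
qed

text \<open>Near the origin the average is at most K and the weight is bounded below. Far away, a
  cube through x that meets the support has side at least |x| / (2 n), while the mass it can catch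
  is at most K (2 R)^n. Hence bounded functions of bounded support have their maximal function in X
  once the weight is there.\<close>

lemma maxop_decay:
  fixes g :: "real^'n \<Rightarrow> ennreal"
  assumes K: "0 \<le> K" and R: "1 \<le> R"
    and g: "\<And>y. g y \<le> ennreal K * indicator (cube (- R *\<^sub>R One) (2 * R)) y"
  shows "maxop g x \<le> ennreal (2 * K * (4 * real CARD('n) * R) ^ CARD('n)) * ennreal (1 / (1 + norm x ^ CARD('n)))"
  unfolding maxop_le_iff[of g]
proof (intro allI impI)
  fix a :: "real^'n" and h :: real assume h: "0 < h" and x: "x \<in> cube a h"
  let ?n = "real CARD('n)" and ?Q0 = "cube (- R *\<^sub>R One :: real^'n) (2 * R)"
  let ?C = "2 * K * (4 * ?n * R) ^ CARD('n)" and ?w = "1 / (1 + norm x ^ CARD('n))"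
  have n1: "1 \<le> ?n" by (rule CARD_ge_1)
  have nR: "1 \<le> ?n * R" using mult_mono[OF n1 R] by simp
  have w: "0 < 1 + norm x ^ CARD('n)" by (simp add: add_pos_nonneg)
  have bound: "cube_int g a h \<le> ennreal (K * t)"
    if "0 \<le> t" and t: "emeasure lebesgue (cube a h \<inter> ?Q0) \<le> ennreal t" for t
  proof -
    have "cube_int g a h \<le> (\<integral>\<^sup>+ y. ennreal K * indicator (cube a h \<inter> ?Q0) y \<partial>lebesgue)"
      unfolding cube_int_def
    proof (intro nn_integral_mono)
      fix y
      show "g y * indicator (cube a h) y \<le> ennreal K * indicator (cube a h \<inter> ?Q0) y"
        using g[of y] by (auto split: split_indicator split_indicator_asm)
    qed
    also have "\<dots> = ennreal K * emeasure lebesgue (cube a h \<inter> ?Q0)"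
      by (simp add: nn_integral_cmult)
    also have "\<dots> \<le> ennreal K * ennreal t" by (intro mult_left_mono t) auto
    finally show ?thesis using K \<open>0 \<le> t\<close> by (simp add: ennreal_mult)
  qed
  have "cube_int g a h \<le> ennreal (?C * ?w * h ^ CARD('n))"
  proof (cases "norm x \<le> 2 * ?n * R")
    case True
    have "emeasure lebesgue (cube a h \<inter> ?Q0) \<le> emeasure lebesgue (cube a h)"
      by (intro emeasure_mono) auto
    then have "cube_int g a h \<le> ennreal (K * h ^ CARD('n))"
      using h by (intro bound) (auto simp: emeasure_cube)
    also have "\<dots> \<le> ennreal (?C * ?w * h ^ CARD('n))"
    proof (intro ennreal_leI mult_right_mono)
      have "norm x ^ CARD('n) \<le> (4 * ?n * R) ^ CARD('n)"
        using True nR by (intro power_mono) auto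
      moreover have "1 \<le> (4 * ?n * R) ^ CARD('n)" using nR by (intro one_le_power) auto
      ultimately have "1 + norm x ^ CARD('n) \<le> 2 * (4 * ?n * R) ^ CARD('n)" by simp
      then have "K * (1 + norm x ^ CARD('n)) \<le> K * (2 * (4 * ?n * R) ^ CARD('n))"
        using K by (rule mult_left_mono)
      then show "K \<le> ?C * ?w" using w by (simp add: pos_le_divide_eq mult_ac)
    qed (use h in auto)
    finally show ?thesis .
  next
    case False
    show ?thesis
    proof (cases "cube a h \<inter> ?Q0 = {}")
      case True
      then show ?thesis using bound[of 0] by simp
    next
      case ne: False
      then obtain z where z: "z \<in> cube a h" "z \<in> ?Q0" by auto
      \<comment> \<open>The cube joins x to z in the support. Summing over coordinates gives norm x
        <= n (R + h), and n R is absorbed because norm x > 2 n R.\<close>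
      have "\<bar>x $ i\<bar> \<le> R + h" for i
        using spec[OF x[unfolded mem_cube], of i] spec[OF z(1)[unfolded mem_cube], of i]
          spec[OF z(2)[unfolded mem_cube], of i] by auto
      then have "norm x \<le> (\<Sum>i\<in>(UNIV::'n set). R + h)"
        by (intro order_trans[OF norm_le_l1_cart] sum_mono) auto
      then have "norm x \<le> 2 * ?n * h" using False by (simp add: algebra_simps)
      then have "norm x ^ CARD('n) \<le> (2 * ?n * h) ^ CARD('n)" by (intro power_mono) auto
      moreover have "1 \<le> norm x ^ CARD('n)" using False nR by (intro one_le_power) auto
      ultimately have *: "1 + norm x ^ CARD('n) \<le> 2 * (2 * ?n * h) ^ CARD('n)" by simp
      have "emeasure lebesgue (cube a h \<inter> ?Q0) \<le> emeasure lebesgue ?Q0"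
        by (intro emeasure_mono) auto
      then have "cube_int g a h \<le> ennreal (K * (2 * R) ^ CARD('n))"
        using R by (intro bound) (auto simp: emeasure_cube)
      also have "\<dots> \<le> ennreal (?C * ?w * h ^ CARD('n))"
      proof (intro ennreal_leI)
        have "K * (2 * R) ^ CARD('n) * (1 + norm x ^ CARD('n)) \<le> K * (2 * R) ^ CARD('n) * (2 * (2 * ?n * h) ^ CARD('n))"
          using K R * by (intro mult_left_mono) auto
        also have "\<dots> = ?C * h ^ CARD('n)"
        proof -
          have "(2 * R) ^ CARD('n) * (2 * ?n * h) ^ CARD('n) = (4 * ?n * R) ^ CARD('n) * h ^ CARD('n)"
            by (simp only: power_mult_distrib[symmetric]) (simp add: mult_ac)
          then show ?thesis by (simp add: mult_ac)
        qed
        finally show "K * (2 * R) ^ CARD('n) \<le> ?C * ?w * h ^ CARD('n)"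
          using w by (simp add: pos_le_divide_eq)
      qed
      finally show ?thesis .
    qed
  qed
  then show "cube_int g a h \<le> ennreal ?C * ennreal ?w * ennreal (h ^ CARD('n))"
    using K R h w by (subst (asm) ennreal_mult, simp, simp, subst (asm) ennreal_mult) auto
qed

section \<open>Banach function norms\<close>

context
  fixes N :: "(real^'n \<Rightarrow> ennreal) \<Rightarrow> ennreal"
  assumes bfs: "banach_function_norm N"
begin

lemma bfs_add:
  "f \<in> borel_measurable lebesgue \<Longrightarrow> g \<in> borel_measurable lebesgue \<Longrightarrow> N (\<lambda>x. f x + g x) \<le> N f + N g"
  using bfs unfolding banach_function_norm_def by blast

lemma bfs_cmult:
  "f \<in> borel_measurable lebesgue \<Longrightarrow> 0 \<le> c \<Longrightarrow> N (\<lambda>x. ennreal c * f x) = ennreal c * N f"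
  using bfs unfolding banach_function_norm_def by blast

lemma bfs_mono_AE:
  "f \<in> borel_measurable lebesgue \<Longrightarrow> g \<in> borel_measurable lebesgue \<Longrightarrow> AE x in lebesgue. g x \<le> f x \<Longrightarrow> N g \<le> N f"
  using bfs unfolding banach_function_norm_def by blast

lemma bfs_mono:
  "f \<in> borel_measurable lebesgue \<Longrightarrow> g \<in> borel_measurable lebesgue \<Longrightarrow> (\<And>x. g x \<le> f x) \<Longrightarrow> N g \<le> N f"
  by (rule bfs_mono_AE) auto

lemma bfs_cong_AE:
  "f \<in> borel_measurable lebesgue \<Longrightarrow> g \<in> borel_measurable lebesgue \<Longrightarrow> AE x in lebesgue. f x = g x \<Longrightarrow> N f = N g"
  by (intro antisym bfs_mono_AE) auto

lemma bfs_SUP: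
  assumes "\<And>j. F j \<in> borel_measurable lebesgue" "\<And>x. incseq (\<lambda>j. F j x)"
  shows "N (\<lambda>x. SUP j. F j x) = (SUP j. N (F j))"
proof -
  have "\<forall>F :: nat \<Rightarrow> real^'n \<Rightarrow> ennreal. \<forall>f \<in> borel_measurable lebesgue.
         (\<forall>j. F j \<in> borel_measurable lebesgue) \<longrightarrow>
         (AE x in lebesgue. incseq (\<lambda>j. F j x) \<and> (SUP j. F j x) = f x) \<longrightarrow>
         N f = (SUP j. N (F j))"
    using bfs unfolding banach_function_norm_def by blast
  from this[rule_format, of "\<lambda>x. SUP j. F j x" F] show ?thesis using assms by auto
qed

text \<open>The axiom on integrals over sets of finite measure gives a finite integral on every
  ball, hence finiteness almost everywhere there; countably many balls exhaust the space.\<close>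

lemma bfs_AE_finite:
  assumes g [measurable]: "g \<in> borel_measurable lebesgue" and fin: "N g < \<infinity>"
  shows "AE x in lebesgue. g x \<noteq> top"
proof -
  have loc: "AE x in lebesgue. g x * indicator (cball 0 (real j)) x \<noteq> top" for j
  proof -
    let ?E = "cball (0::real^'n) (real j)"
    have "\<forall>E \<in> sets lebesgue. emeasure lebesgue E < \<infinity> \<longrightarrow>
         (\<exists>C::real. \<forall>f \<in> borel_measurable lebesgue. set_nn_integral lebesgue E f \<le> ennreal C * N f)"
      using bfs unfolding banach_function_norm_def by blast
    moreover have "emeasure lebesgue ?E < \<infinity>"
      using emeasure_lborel_cball_finite[of "0::real^'n" "real j"] by (simp add: emeasure_completion)
    ultimately obtain C where "\<forall>f \<in> borel_measurable lebesgue. set_nn_integral lebesgue ?E f \<le> ennreal C * N f"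
      by (auto dest: bspec[of _ _ ?E])
    then have "set_nn_integral lebesgue ?E g \<le> ennreal C * N g" using g by blast
    also have "\<dots> < top" using fin by (simp add: ennreal_mult_less_top)
    finally have "set_nn_integral lebesgue ?E g \<noteq> \<infinity>" by simp
    moreover have "(\<lambda>x. g x * indicator ?E x) \<in> borel_measurable lebesgue"
      using g by (intro borel_measurable_times_ennreal borel_measurable_indicator) auto
    ultimately show ?thesis using nn_integral_noteq_infinite[of "\<lambda>x. g x * indicator ?E x" lebesgue] by simp
  qed
  then have "AE x in lebesgue. \<forall>j. g x * indicator (cball 0 (real j)) x \<noteq> top"
    by (simp add: AE_all_countable)
  then show ?thesis
  proof eventually_elim
    case (elim x)
    obtain j where "norm x \<le> real j" using real_arch_simple by blast
    then show ?case using elim[rule_format, of j] by simp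
  qed
qed

end

section \<open>Equivalence of boundedness on MX with the local maximal inequality\<close>

theorem theorem2p3:
  fixes N :: "(real^'n \<Rightarrow> ennreal) \<Rightarrow> ennreal"
  assumes bfs: "banach_function_norm N"
    and weight: "in_bfs N (\<lambda>x. 1 / (1 + norm x ^ CARD('n)))"
  shows "(\<exists>C::real. C > 0 \<and>
            (\<forall>f. f \<in> borel_measurable lebesgue \<and> N (M f) < \<infinity> \<longrightarrow>
                 N (maxop (M f)) \<le> ennreal C * N (M f)))
     \<longleftrightarrow> (\<exists>lam0::real. 0 < lam0 \<and> lam0 < 1 \<and>
            (\<forall>f. in_bfs N f \<longrightarrow> N (M f) \<le> 2 * N (local_maxop lam0 f)))"
proof
  assume "\<exists>C::real. C > 0 \<and> (\<forall>f. f \<in> borel_measurable lebesgue \<and> N (M f) < \<infinity> \<longrightarrow>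
                 N (maxop (M f)) \<le> ennreal C * N (M f))"
  then obtain C where C: "0 < C" "\<And>f. f \<in> borel_measurable lebesgue \<Longrightarrow> N (M f) < \<infinity> \<Longrightarrow>
                 N (maxop (M f)) \<le> ennreal C * N (M f)" by blast
  define D where "D = 4 * (30 * real CARD('n)) ^ CARD('n)"
  have D: "0 \<le> D" by (simp add: D_def)
  \<comment> \<open>With this choice the MMf term has at most half the norm of Mf; absorbing it
    produces the factor 2. Taking \<open>Suc\<close> keeps \<open>K\<close> positive.\<close>
  obtain K0 :: nat where K0: "2 * D * C \<le> real K0" using real_arch_simple by blast
  define K where "K = Suc K0"
  have K: "0 < K" "D / real K * C \<le> 1 / 2" using K0 by (auto simp: K_def field_simps)
  define lam where "lam = (1 / 2 ^ Suc K :: real)"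
  have lam: "0 < lam" "lam < 1"
    unfolding lam_def using one_less_power[of "2::real" "Suc K"] by (auto simp del: power_Suc)
  \<comment> \<open>Half of \<open>N (M f)\<close> is cancelled on both sides, which requires this
    norm to be finite.\<close>
  have fin_case: "N (M f) \<le> 2 * N (local_maxop lam f)"
    if f [measurable]: "f \<in> borel_measurable lebesgue" and fin: "N (M f) < \<infinity>" for f
  proof -
    obtain r where r: "N (M f) = ennreal r" "0 \<le> r" using fin by (cases "N (M f)") auto
    have "N (\<lambda>x. ennreal (D / real K) * maxop (M f) x) = ennreal (D / real K) * N (maxop (M f))"
      using D by (intro bfs_cmult[OF bfs]) auto
    also have "\<dots> \<le> ennreal (D / real K) * (ennreal C * N (M f))"
      by (intro mult_left_mono C(2) f fin) auto
    also have "\<dots> = ennreal (D / real K * C * r)"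
      using r(2) C(1) D by (simp add: r(1) mult.assoc flip: ennreal_mult)
    also have "\<dots> \<le> ennreal (1 / 2 * r)" using mult_right_mono[OF K(2) r(2)] by (rule ennreal_leI)
    finally have half: "N (\<lambda>x. ennreal (D / real K) * maxop (M f) x) \<le> ennreal (r / 2)" by simp
    have "N (M f) \<le> N (\<lambda>x. local_maxop lam f x + ennreal (D / real K) * maxop (M f) x)"
      using M_le_local_maxop_plus[OF f K(1)] unfolding lam_def D_def by (intro bfs_mono[OF bfs]) auto
    also have "\<dots> \<le> N (local_maxop lam f) + N (\<lambda>x. ennreal (D / real K) * maxop (M f) x)"
      by (intro bfs_add[OF bfs]) auto
    also have "\<dots> \<le> N (local_maxop lam f) + ennreal (r / 2)" by (rule add_left_mono[OF half])
    finally have "ennreal r \<le> N (local_maxop lam f) + ennreal (r / 2)" unfolding r(1) .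
    moreover have "ennreal r = ennreal (r / 2) + ennreal (r / 2)" using r by (simp flip: ennreal_plus)
    ultimately have "ennreal (r / 2) \<le> N (local_maxop lam f)"
      by (simp add: add.commute ennreal_add_left_cancel_le)
    then have "2 * ennreal (r / 2) \<le> 2 * N (local_maxop lam f)" by (intro mult_left_mono) auto
    moreover have "2 * ennreal (r / 2) = ennreal r" using r by (simp add: mult_2 flip: ennreal_plus)
    ultimately show ?thesis by (simp add: r)
  qed
  have "N (M f) \<le> 2 * N (local_maxop lam f)" if "in_bfs N f" for f
  proof -
    have f [measurable]: "f \<in> borel_measurable lebesgue" using that by (simp add: in_bfs_def)
    \<comment> \<open>The radius is \<open>Suc j\<close> because \<open>maxop_decay\<close> asks for
      a radius of at least 1; the same number caps the height in \<open>F\<close>.\<close>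
    define Q where "Q j = cube (- real (Suc j) *\<^sub>R One :: real^'n) (2 * real (Suc j))" for j
    have Q_mono: "Q i \<subseteq> Q j" if "i \<le> j" for i j
      unfolding Q_def using that by (intro cube_subsetI) auto
    have Q_ex: "\<exists>j. y \<in> Q j \<and> \<bar>f y\<bar> \<le> real (Suc j)" for y
    proof -
      obtain j where j: "max (norm y) \<bar>f y\<bar> \<le> real j" using real_arch_simple by blast
      have "y \<in> Q j" unfolding Q_def mem_cube
      proof
        fix i show "(- real (Suc j) *\<^sub>R One :: real^'n) $ i \<le> y $ i \<and> y $ i \<le> (- real (Suc j) *\<^sub>R One :: real^'n) $ i + 2 * real (Suc j)"
          using component_le_norm_cart[of y i] j by auto
      qed
      then show ?thesis using j by (intro exI[of _ j]) auto
    qed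
    define F where "F j y = min \<bar>f y\<bar> (real (Suc j)) * indicator (Q j) y" for j y
    have [measurable]: "Q j \<in> sets lebesgue" for j by (simp add: Q_def)
    have F_meas [measurable]: "F j \<in> borel_measurable lebesgue" for j unfolding F_def by measurable
    have F_nonneg: "0 \<le> F j y" for j y by (simp add: F_def)
    have F_le: "F j y \<le> \<bar>f y\<bar>" for j y by (simp add: F_def split: split_indicator)
    have F_mono: "F i y \<le> F j y" if "i \<le> j" for i j y
      using Q_mono[OF that] that by (auto simp: F_def split: split_indicator)
    have inc: "incseq (\<lambda>j. ennreal \<bar>F j y\<bar>)" for y
      using F_mono F_nonneg by (auto simp: incseq_def intro!: ennreal_leI)
    have SUP_F: "(SUP j. ennreal \<bar>F j y\<bar>) = ennreal \<bar>f y\<bar>" for y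
    proof (rule antisym)
      show "(SUP j. ennreal \<bar>F j y\<bar>) \<le> ennreal \<bar>f y\<bar>"
        using F_le F_nonneg by (intro SUP_least ennreal_leI) auto
      obtain j where "y \<in> Q j" "\<bar>f y\<bar> \<le> real (Suc j)" using Q_ex by blast
      then have "F j y = \<bar>f y\<bar>" by (simp add: F_def)
      then show "ennreal \<bar>f y\<bar> \<le> (SUP j. ennreal \<bar>F j y\<bar>)" by (intro SUP_upper2[of j]) auto
    qed
    have M_f: "M f = (\<lambda>x. SUP j. M (F j) x)"
      using maxop_SUP[of "\<lambda>j y. ennreal \<bar>F j y\<bar>"] inc by (auto simp: SUP_F fun_eq_iff)
    have N_f: "N (\<lambda>x. SUP j. M (F j) x) = (SUP j. N (M (F j)))"
    proof (rule bfs_SUP[OF bfs])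
      fix x show "incseq (\<lambda>j. M (F j) x)"
        using inc by (auto simp: incseq_def intro!: maxop_mono)
    qed auto
    \<comment> \<open>The weight dominates \<open>M (F j)\<close> up to the constant
      \<open>c\<close> of \<open>maxop_decay\<close> with height and radius \<open>Suc j\<close>, so
      \<open>fin_case\<close> applies to each truncation.\<close>
    have "N (M (F j)) \<le> 2 * N (local_maxop lam f)" for j
    proof -
      define w where "w x = ennreal (1 / (1 + norm x ^ CARD('n)))" for x :: "real^'n"
      define c where "c = 2 * real (Suc j) * (4 * real CARD('n) * real (Suc j)) ^ CARD('n)"
      have "w = (\<lambda>x. ennreal \<bar>1 / (1 + norm x ^ CARD('n))\<bar>)" by (auto simp: w_def)
      then have w [measurable]: "w \<in> borel_measurable lebesgue" and w_fin: "N w < top"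
        using weight by (simp_all add: in_bfs_def)
      have "M (F j) x \<le> ennreal c * w x" for x
        unfolding w_def c_def
      proof (rule maxop_decay)
        fix y
        show "ennreal \<bar>F j y\<bar> \<le> ennreal (real (Suc j)) * indicator (cube (- real (Suc j) *\<^sub>R One) (2 * real (Suc j))) y"
          unfolding F_def Q_def by (auto simp del: of_nat_Suc split: split_indicator intro!: ennreal_leI)
      qed auto
      then have "N (M (F j)) \<le> N (\<lambda>x. ennreal c * w x)"
        by (intro bfs_mono[OF bfs]) auto
      also have "\<dots> = ennreal c * N w"
        by (intro bfs_cmult[OF bfs] w) (auto simp: c_def)
      also have "\<dots> < top" using w_fin by (simp add: ennreal_mult_less_top)
      finally have "N (M (F j)) < \<infinity>" by simp
      then have "N (M (F j)) \<le> 2 * N (local_maxop lam (F j))" by (intro fin_case) auto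
      also have "\<dots> \<le> 2 * N (local_maxop lam f)"
        using F_le F_nonneg by (intro mult_left_mono bfs_mono[OF bfs] local_maxop_mono) auto
      finally show ?thesis .
    qed
    then show ?thesis unfolding M_f N_f by (rule SUP_least)
  qed
  with lam show "\<exists>lam0::real. 0 < lam0 \<and> lam0 < 1 \<and>
            (\<forall>f. in_bfs N f \<longrightarrow> N (M f) \<le> 2 * N (local_maxop lam0 f))" by blast
next
  assume "\<exists>lam0::real. 0 < lam0 \<and> lam0 < 1 \<and>
            (\<forall>f. in_bfs N f \<longrightarrow> N (M f) \<le> 2 * N (local_maxop lam0 f))"
  then obtain lam where lam: "0 < lam" "\<And>f. in_bfs N f \<Longrightarrow> N (M f) \<le> 2 * N (local_maxop lam f)" by blast
  \<comment> \<open>The constant of \<open>local_maxop_maxop_le\<close>; the factor 2 of the assumed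
    inequality doubles it below.\<close>
  define C where "C = (30 * real CARD('n)) ^ CARD('n) / lam + 3 ^ CARD('n)"
  have C: "0 < C" using lam(1) by (simp add: C_def add_nonneg_pos)
  have bound: "N (maxop (M f)) \<le> ennreal (2 * C) * N (M f)"
    if f [measurable]: "f \<in> borel_measurable lebesgue" and fin: "N (M f) < \<infinity>" for f
  proof -
    \<comment> \<open>The assumed inequality concerns real functions, so it is applied to
      \<open>F\<close>, which agrees with \<open>M f\<close> almost everywhere because
      \<open>M f\<close> has finite norm.\<close>
    define F where "F y = enn2real (M f y)" for y
    have [measurable]: "F \<in> borel_measurable lebesgue" unfolding F_def by measurable
    have "AE y in lebesgue. M f y \<noteq> top" by (rule bfs_AE_finite[OF bfs _ fin]) auto
    then have AE: "AE y in lebesgue. ennreal \<bar>F y\<bar> = M f y"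
      by eventually_elim (simp add: F_def top.not_eq_extremum)
    have "N (\<lambda>y. ennreal \<bar>F y\<bar>) = N (M f)" using AE by (intro bfs_cong_AE[OF bfs]) auto
    then have "in_bfs N F" using fin by (simp add: in_bfs_def)
    \<comment> \<open>Averages ignore null sets, so the two maximal functions agree at every
      point.\<close>
    have MF: "maxop (M f) = M F"
      by (rule ext) (rule maxop_cong_AE[OF AE, symmetric])
    have "N (maxop (M f)) \<le> 2 * N (local_maxop lam F)"
      unfolding MF by (rule lam(2)[OF \<open>in_bfs N F\<close>])
    also have "N (local_maxop lam F) \<le> N (\<lambda>x. ennreal C * M f x)"
      using local_maxop_maxop_le[OF _ lam(1), of "\<lambda>y. ennreal \<bar>f y\<bar>"]
      by (intro bfs_mono[OF bfs]) (auto simp: F_def[abs_def] C_def)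
    also have "\<dots> = ennreal C * N (M f)" using C by (intro bfs_cmult[OF bfs]) auto
    also have "2 * (ennreal C * N (M f)) = ennreal (2 * C) * N (M f)"
      using C by (simp add: ennreal_mult mult.assoc)
    finally show ?thesis by (simp add: mult_left_mono)
  qed
  show "\<exists>C::real. C > 0 \<and> (\<forall>f. f \<in> borel_measurable lebesgue \<and> N (M f) < \<infinity> \<longrightarrow>
                 N (maxop (M f)) \<le> ennreal C * N (M f))"
  proof (intro exI conjI allI impI)
    show "0 < 2 * C" using C by simp
    fix f :: "real^'n \<Rightarrow> real"
    assume "f \<in> borel_measurable lebesgue \<and> N (M f) < \<infinity>"
    then show "N (maxop (M f)) \<le> ennreal (2 * C) * N (M f)" using bound by blast
  qed
qed

end
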